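(* Let $a,b\in\mathbb{R}$ with $b\neq0$, and let $\zeta_1,\zeta_2,\alpha>0$. Let $\eta_2,Q,R$ be the one-form and polynomials defined in the context, and let $\Gamma=\{(f,g)\in\mathbb{R}^2: Q(f,g)=0\}$. Fix an open quadrant $\mathcal{Q}_\sigma=I\times J$ with $I,J\in\{(0,\infty),(-\infty,0)\}$. Let $p$ be the unique zero of $\eta_2$ in $\mathcal{Q}_\sigma$, and let $O$ be the connected component of $\Gamma\cap\mathcal{Q}_\sigma$ containing $p$. Assume that the system $Q=R=0$ has finitely many solutions in $(\mathbb{C}^* )^2$ and that $\Gamma$ is nonsingular along $O$ (i.e. $dQ\neq0$ at every point of $O$). Then the system $Q=R=0$ has total intersection multiplicity at least $4$ in $\mathcal{Q}_\sigma$; that is, the sum over all real solutions $z\in\mathcal{Q}_\sigma$ of $Q=R=0$ of the local intersection multiplicities of $\{Q=0\}$ and $\{R=0\}$ at $z$ is at least $4$.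
   Context: In the variables $(f,g)$ put $$\xi_1(f,g)=(ag+\zeta_2 f)^2+b^2g^2,\qquad \xi_2(g)=((a-1)g-\zeta_1)^2+b^2g^2,$$ $$\xi_3(f)=((a-1)\zeta_2 f+a\zeta_1)^2+b^2(\zeta_2 f+\zeta_1)^2.$$ (For $b\ne0$, $\zeta_1,\zeta_2>0$, the form $\xi_1$ is positive definite and $\xi_2,\xi_3$ are strictly positive on $\mathbb{R}$.) Define the closed rational one-forms $$\eta_1=\frac{df}{(\alpha+1)f}+\frac{d\xi_2}{\xi_2}-\frac{d\xi_1}{\xi_1}=d\log\Bigl(f^{1/(\alpha+1)}\frac{\xi_2}{\xi_1}\Bigr),$$ $$\eta_2=P(f)\,df+S(g)\,dg,\quad P(f)=-\frac{1}{(\alpha+1)f}+\frac{\xi_3'(f)}{\xi_3(f)},\quad S(g)=\frac{1}{(\alpha+1)g}-\frac{\xi_2'(g)}{\xi_2(g)}.$$ The polynomials $Q,R$ in $(f,g)$ are defined by $$Q\,df\wedge dg=fg\,\xi_1\xi_2\xi_3\,\eta_1\wedge\eta_2,\qquad R\,df\wedge dg=fg\,\xi_2\xi_3\,dQ\wedge\eta_2.$$ A zero of $\eta_2$ is a point where both coefficients $P(f)$ and $S(g)$ vanish; in each open quadrant of the $(f,g)$-plane $\eta_2$ has exactly one zero, and $Q$ vanishes there because of its definition. *)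

theory Defs
  imports
    "HOL-Analysis.Analysis"
    "HOL-Computational_Algebra.Polynomial_Factorial"
    "HOL-Library.Extended_Nat"
begin

text \<open>
  A polynomial in \<open>(f, g)\<close> is a polynomial in \<open>g\<close> whose coefficients are polynomials in \<open>f\<close>;
  rational functions are the elements of the fraction field of this ring.
\<close>

type_synonym 'a bpoly = "'a poly poly"
type_synonym 'a ratfun = "'a poly poly fract"

definition cst :: "'a::comm_ring_1 \<Rightarrow> 'a bpoly" where
  "cst c = [:[:c:]:]"

definition var_f :: "'a::comm_ring_1 bpoly" where
  "var_f = [:[:0, 1:]:]"

definition var_g :: "'a::comm_ring_1 bpoly" where
  "var_g = [:0, 1:]"

definition eval2 :: "'a::comm_ring_1 bpoly \<Rightarrow> 'a \<times> 'a \<Rightarrow> 'a" where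
  "eval2 p z = poly (poly p [:snd z:]) (fst z)"

definition diff_f :: "'a::idom bpoly \<Rightarrow> 'a bpoly" where
  "diff_f p = map_poly pderiv p"

definition diff_g :: "'a::idom bpoly \<Rightarrow> 'a bpoly" where
  "diff_g p = pderiv p"

definition complexify :: "real bpoly \<Rightarrow> complex bpoly" where
  "complexify p = map_poly (map_poly complex_of_real) p"

text \<open>The pair \<open>(A, B)\<close> stands for the rational one-form \<open>A df + B dg\<close>.\<close>

type_synonym 'a ratform = "'a ratfun \<times> 'a ratfun"

definition dform :: "'a::idom bpoly \<Rightarrow> 'a ratform" where
  "dform p = (to_fract (diff_f p), to_fract (diff_g p))"

definition scale_form :: "'a::idom ratfun \<Rightarrow> 'a ratform \<Rightarrow> 'a ratform" where
  "scale_form r w = (r * fst w, r * snd w)"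

text \<open>The coefficient of \<open>df \<and> dg\<close> in \<open>w \<and> w'\<close>.\<close>

definition wedge :: "'a::idom ratform \<Rightarrow> 'a ratform \<Rightarrow> 'a ratfun" where
  "wedge w w' = fst w * snd w' - snd w * fst w'"

definition vanishes_at :: "'a::idom ratfun \<Rightarrow> 'a \<times> 'a \<Rightarrow> bool" where
  "vanishes_at r z \<longleftrightarrow> (\<exists>p q. r = Fract p q \<and> eval2 q z \<noteq> 0 \<and> eval2 p z = 0)"

definition form_zero :: "'a::idom ratform \<Rightarrow> 'a \<times> 'a \<Rightarrow> bool" where
  "form_zero w z \<longleftrightarrow> vanishes_at (fst w) z \<and> vanishes_at (snd w) z"


definition local_ring :: "'a::idom \<times> 'a \<Rightarrow> 'a ratfun set" where
  "local_ring z = {Fract p q | p q. eval2 q z \<noteq> 0}"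

definition local_ideal :: "'a::idom \<times> 'a \<Rightarrow> 'a bpoly \<Rightarrow> 'a bpoly \<Rightarrow> 'a ratfun set" where
  "local_ideal z F G =
     {A * to_fract F + B * to_fract G | A B. A \<in> local_ring z \<and> B \<in> local_ring z}"

text \<open>
  The local intersection multiplicity of \<open>F = 0\<close> and \<open>G = 0\<close> at \<open>z\<close> is the dimension over the
  ground field of the quotient of the local ring at \<open>z\<close> by the ideal generated by \<open>F\<close> and \<open>G\<close>,
  i.e. the supremum of the cardinalities of the finite sets that are linearly independent modulo
  this ideal. It is infinite if \<open>F\<close> and \<open>G\<close> have a common component through \<open>z\<close>, and 0 if
  \<open>z\<close> is not a common zero.
\<close>

definition indep_mod :: "'a::idom ratfun set \<Rightarrow> 'a ratfun set \<Rightarrow> bool" where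
  "indep_mod M B \<longleftrightarrow>
     (\<forall>c. (\<Sum>s\<in>B. to_fract (cst (c s)) * s) \<in> M \<longrightarrow> (\<forall>s\<in>B. c s = 0))"

definition intersection_mult :: "'a::field bpoly \<Rightarrow> 'a bpoly \<Rightarrow> 'a \<times> 'a \<Rightarrow> enat" where
  "intersection_mult F G z =
     (SUP B \<in> {B. finite B \<and> B \<subseteq> local_ring z \<and> indep_mod (local_ideal z F G) B}. enat (card B))"


definition xi1 :: "real \<Rightarrow> real \<Rightarrow> real \<Rightarrow> real bpoly" where
  "xi1 a b \<zeta>2 = (cst a * var_g + cst \<zeta>2 * var_f)^2 + cst b^2 * var_g^2"

definition xi2 :: "real \<Rightarrow> real \<Rightarrow> real \<Rightarrow> real bpoly" where
  "xi2 a b \<zeta>1 = (cst (a - 1) * var_g - cst \<zeta>1)^2 + cst b^2 * var_g^2"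

definition xi3 :: "real \<Rightarrow> real \<Rightarrow> real \<Rightarrow> real \<Rightarrow> real bpoly" where
  "xi3 a b \<zeta>1 \<zeta>2 = (cst ((a - 1) * \<zeta>2) * var_f + cst (a * \<zeta>1))^2
                 + cst b^2 * (cst \<zeta>2 * var_f + cst \<zeta>1)^2"

definition eta1 :: "real \<Rightarrow> real \<Rightarrow> real \<Rightarrow> real \<Rightarrow> real \<Rightarrow> real ratform" where
  "eta1 a b \<zeta>1 \<zeta>2 \<alpha> =
     scale_form (1 / (to_fract (cst (\<alpha> + 1)) * to_fract var_f)) (dform var_f)
     + scale_form (1 / to_fract (xi2 a b \<zeta>1)) (dform (xi2 a b \<zeta>1))
     - scale_form (1 / to_fract (xi1 a b \<zeta>2)) (dform (xi1 a b \<zeta>2))"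

definition P_fun :: "real \<Rightarrow> real \<Rightarrow> real \<Rightarrow> real \<Rightarrow> real \<Rightarrow> real ratfun" where
  "P_fun a b \<zeta>1 \<zeta>2 \<alpha> =
     - (1 / (to_fract (cst (\<alpha> + 1)) * to_fract var_f))
     + to_fract (diff_f (xi3 a b \<zeta>1 \<zeta>2)) / to_fract (xi3 a b \<zeta>1 \<zeta>2)"

definition S_fun :: "real \<Rightarrow> real \<Rightarrow> real \<Rightarrow> real \<Rightarrow> real ratfun" where
  "S_fun a b \<zeta>1 \<alpha> =
     1 / (to_fract (cst (\<alpha> + 1)) * to_fract var_g)
     - to_fract (diff_g (xi2 a b \<zeta>1)) / to_fract (xi2 a b \<zeta>1)"

definition eta2 :: "real \<Rightarrow> real \<Rightarrow> real \<Rightarrow> real \<Rightarrow> real \<Rightarrow> real ratform" where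
  "eta2 a b \<zeta>1 \<zeta>2 \<alpha> =
     scale_form (P_fun a b \<zeta>1 \<zeta>2 \<alpha>) (dform var_f) + scale_form (S_fun a b \<zeta>1 \<alpha>) (dform var_g)"

text \<open>
  \<open>Q\<close> and \<open>R\<close> are given as the polynomials representing certain rational functions; that these
  rational functions are polynomials is proved in \<open>to_fract_Q_poly\<close> and \<open>to_fract_R_poly\<close> below.
\<close>

definition Q_poly :: "real \<Rightarrow> real \<Rightarrow> real \<Rightarrow> real \<Rightarrow> real \<Rightarrow> real bpoly" where
  "Q_poly a b \<zeta>1 \<zeta>2 \<alpha> = (THE q. to_fract q =
     to_fract (var_f * var_g * xi1 a b \<zeta>2 * xi2 a b \<zeta>1 * xi3 a b \<zeta>1 \<zeta>2)
     * wedge (eta1 a b \<zeta>1 \<zeta>2 \<alpha>) (eta2 a b \<zeta>1 \<zeta>2 \<alpha>))"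

definition R_poly :: "real \<Rightarrow> real \<Rightarrow> real \<Rightarrow> real \<Rightarrow> real \<Rightarrow> real bpoly" where
  "R_poly a b \<zeta>1 \<zeta>2 \<alpha> = (THE r. to_fract r =
     to_fract (var_f * var_g * xi2 a b \<zeta>1 * xi3 a b \<zeta>1 \<zeta>2)
     * wedge (dform (Q_poly a b \<zeta>1 \<zeta>2 \<alpha>)) (eta2 a b \<zeta>1 \<zeta>2 \<alpha>))"

definition Gamma_curve :: "real \<Rightarrow> real \<Rightarrow> real \<Rightarrow> real \<Rightarrow> real \<Rightarrow> (real \<times> real) set" where
  "Gamma_curve a b \<zeta>1 \<zeta>2 \<alpha> = {z. eval2 (Q_poly a b \<zeta>1 \<zeta>2 \<alpha>) z = 0}"


lemma eval2_simps [simp]: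
  "eval2 (p + q) z = eval2 p z + eval2 q z"
  "eval2 (p - q) z = eval2 p z - eval2 q z"
  "eval2 (p * q) z = eval2 p z * eval2 q z"
  "eval2 (p ^ n) z = eval2 p z ^ n"
  "eval2 (cst c) z = c"
  "eval2 var_f z = fst z"
  "eval2 var_g z = snd z"
  "eval2 0 z = 0"
  by (simp_all add: eval2_def cst_def var_f_def var_g_def)

lemma eval2_xi1: "eval2 (xi1 a b \<zeta>2) (x, y) = (a * y + \<zeta>2 * x)^2 + b^2 * y^2"
  by (simp add: xi1_def)

lemma eval2_xi2: "eval2 (xi2 a b \<zeta>1) (x, y) = ((a - 1) * y - \<zeta>1)^2 + b^2 * y^2"
  by (simp add: xi2_def)

lemma eval2_xi3:
  "eval2 (xi3 a b \<zeta>1 \<zeta>2) (x, y) = ((a - 1) * \<zeta>2 * x + a * \<zeta>1)^2 + b^2 * (\<zeta>2 * x + \<zeta>1)^2"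
  by (simp add: xi3_def)

lemma xi_nonzero:
  assumes "b \<noteq> 0" "\<zeta>1 > 0" "\<zeta>2 > 0"
  shows "xi1 a b \<zeta>2 \<noteq> 0" "xi2 a b \<zeta>1 \<noteq> 0" "xi3 a b \<zeta>1 \<zeta>2 \<noteq> 0"
proof -
  have "eval2 (xi1 a b \<zeta>2) (1, 0) \<noteq> 0" "eval2 (xi2 a b \<zeta>1) (0, 0) \<noteq> 0"
    using assms by (simp_all add: eval2_xi1 eval2_xi2)
  moreover have "eval2 (xi3 a b \<zeta>1 \<zeta>2) (0, 0) \<noteq> 0"
    using assms by (simp add: eval2_xi3 sum_power2_eq_zero_iff flip: power_mult_distrib)
  ultimately show "xi1 a b \<zeta>2 \<noteq> 0" "xi2 a b \<zeta>1 \<noteq> 0" "xi3 a b \<zeta>1 \<zeta>2 \<noteq> 0"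
    by auto
qed

lemma var_nonzero: "var_f \<noteq> (0 :: real bpoly)" "var_g \<noteq> (0 :: real bpoly)"
  by (simp_all add: var_f_def var_g_def)

lemma dform_var:
  "dform var_f = (1, 0 :: real ratfun)" "dform var_g = (0, 1 :: real ratfun)"
  by (simp_all add: dform_def diff_f_def diff_g_def var_f_def var_g_def map_poly_pCons
      pderiv_pCons one_pCons to_fract_def One_fract_def Zero_fract_def)

lemma diff_f_xi2: "diff_f (xi2 a b \<zeta>1) = 0"
  by (simp add: diff_f_def xi2_def cst_def var_g_def power2_eq_square map_poly_pCons pderiv_pCons
      algebra_simps)

lemma eta1_eq:
  "eta1 a b \<zeta>1 \<zeta>2 \<alpha> =
     (1 / (to_fract (cst (\<alpha> + 1)) * to_fract var_f)
        - to_fract (diff_f (xi1 a b \<zeta>2)) / to_fract (xi1 a b \<zeta>2),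
      to_fract (diff_g (xi2 a b \<zeta>1)) / to_fract (xi2 a b \<zeta>1)
        - to_fract (diff_g (xi1 a b \<zeta>2)) / to_fract (xi1 a b \<zeta>2))"
  by (simp add: eta1_def dform_var scale_form_def) (simp add: dform_def diff_f_xi2)

lemma eta2_eq: "eta2 a b \<zeta>1 \<zeta>2 \<alpha> = (P_fun a b \<zeta>1 \<zeta>2 \<alpha>, S_fun a b \<zeta>1 \<alpha>)"
  by (simp add: eta2_def dform_var scale_form_def)

lemma cst_inverse: "c \<noteq> 0 \<Longrightarrow> to_fract (cst (1 / c)) = 1 / to_fract (cst (c :: real))"
proof -
  assume c: "c \<noteq> 0"
  have "cst (1 / c) * cst c = 1"
    using c by (simp add: cst_def flip: one_pCons)
  hence "to_fract (cst (1 / c)) * to_fract (cst c) = 1"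
    by (metis to_fract_1 to_fract_mult)
  moreover from this have "to_fract (cst c) \<noteq> 0" by force
  ultimately show ?thesis by (simp add: field_simps)
qed

lemma Q_identity:
  fixes k f g x1 x2 x3 :: "'a::field"
  assumes "k \<noteq> 0" "f \<noteq> 0" "g \<noteq> 0" "x1 \<noteq> 0" "x2 \<noteq> 0" "x3 \<noteq> 0"
  shows "f * g * x1 * x2 * x3 *
      ((1 / (k * f) - x1f / x1) * (1 / (k * g) - x2g / x2)
       - (x2g / x2 - x1g / x1) * (- (1 / (k * f)) + x3f / x3))
    = 1 / k * (1 / k) * x3 * (x1 - k * f * x1f) * (x2 - k * g * x2g)
      - 1 / k * g * (x2g * x1 - x2 * x1g) * (k * f * x3f - x3)"
proof -
  have 1: "1 / (k * f) - x1f / x1 = (x1 - k * f * x1f) / (k * f * x1)"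
       "1 / (k * g) - x2g / x2 = (x2 - k * g * x2g) / (k * g * x2)"
       "x2g / x2 - x1g / x1 = (x2g * x1 - x2 * x1g) / (x1 * x2)"
       "- (1 / (k * f)) + x3f / x3 = (k * f * x3f - x3) / (k * f * x3)"
    using assms by (simp_all add: field_simps)
  show ?thesis unfolding 1 using assms by (simp add: divide_simps)
qed

lemma R_identity:
  fixes k f g x2 x3 :: "'a::field"
  assumes "k \<noteq> 0" "f \<noteq> 0" "g \<noteq> 0" "x2 \<noteq> 0" "x3 \<noteq> 0"
  shows "f * g * x2 * x3 *
      (qf * (1 / (k * g) - x2g / x2) - qg * (- (1 / (k * f)) + x3f / x3))
    = 1 / k * f * x3 * qf * (x2 - k * g * x2g) - 1 / k * g * x2 * qg * (k * f * x3f - x3)"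
proof -
  have 1: "1 / (k * g) - x2g / x2 = (x2 - k * g * x2g) / (k * g * x2)"
       "- (1 / (k * f)) + x3f / x3 = (k * f * x3f - x3) / (k * f * x3)"
    using assms by (simp_all add: field_simps)
  show ?thesis unfolding 1 using assms by (simp add: divide_simps)
qed

lemma the_to_fract:
  fixes r :: "real ratfun"
  assumes "r = to_fract q"
  shows "(THE q. to_fract q = r) = q"
  using assms by (simp add: the_equality)

context
  fixes a b \<zeta>1 \<zeta>2 \<alpha> :: real
  assumes b: "b \<noteq> 0" and z1: "\<zeta>1 > 0" and z2: "\<zeta>2 > 0" and al: "\<alpha> > 0"
begin

lemma Q_poly_eq:
  defines "x1 \<equiv> xi1 a b \<zeta>2" and "x2 \<equiv> xi2 a b \<zeta>1" and "x3 \<equiv> xi3 a b \<zeta>1 \<zeta>2"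
    and "k \<equiv> cst (\<alpha> + 1)" and "k' \<equiv> cst (1 / (\<alpha> + 1))"
  shows "Q_poly a b \<zeta>1 \<zeta>2 \<alpha> =
      k' * k' * x3 * (x1 - k * var_f * diff_f x1) * (x2 - k * var_g * diff_g x2)
      - k' * var_g * (diff_g x2 * x1 - x2 * diff_g x1) * (k * var_f * diff_f x3 - x3)"
proof -
  have k: "to_fract k \<noteq> 0" "to_fract k' = 1 / to_fract k"
    using al by (auto simp: k_def k'_def cst_inverse) (simp add: cst_def)
  have nz: "to_fract x1 \<noteq> 0" "to_fract x2 \<noteq> 0" "to_fract x3 \<noteq> 0"
    "to_fract (var_f :: real bpoly) \<noteq> 0" "to_fract (var_g :: real bpoly) \<noteq> 0"
    using xi_nonzero[OF b z1 z2] var_nonzero by (simp_all add: x1_def x2_def x3_def)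
  show ?thesis
    unfolding Q_poly_def
    by (rule the_to_fract)
      (simp only: wedge_def eta1_eq eta2_eq fst_conv snd_conv P_fun_def S_fun_def to_fract_mult
        to_fract_diff k Q_identity[OF k(1) nz(4,5,1,2,3)] flip: x1_def x2_def x3_def k_def)
qed

lemma R_poly_eq:
  defines "x2 \<equiv> xi2 a b \<zeta>1" and "x3 \<equiv> xi3 a b \<zeta>1 \<zeta>2" and "q \<equiv> Q_poly a b \<zeta>1 \<zeta>2 \<alpha>"
    and "k \<equiv> cst (\<alpha> + 1)" and "k' \<equiv> cst (1 / (\<alpha> + 1))"
  shows "R_poly a b \<zeta>1 \<zeta>2 \<alpha> =
      k' * var_f * x3 * diff_f q * (x2 - k * var_g * diff_g x2)
      - k' * var_g * x2 * diff_g q * (k * var_f * diff_f x3 - x3)"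
proof -
  have k: "to_fract k \<noteq> 0" "to_fract k' = 1 / to_fract k"
    using al by (auto simp: k_def k'_def cst_inverse) (simp add: cst_def)
  have nz: "to_fract x2 \<noteq> 0" "to_fract x3 \<noteq> 0"
    "to_fract (var_f :: real bpoly) \<noteq> 0" "to_fract (var_g :: real bpoly) \<noteq> 0"
    using xi_nonzero[OF b z1 z2] var_nonzero by (simp_all add: x2_def x3_def)
  show ?thesis
    unfolding R_poly_def
    by (rule the_to_fract)
      (simp only: wedge_def dform_def eta2_eq fst_conv snd_conv P_fun_def S_fun_def to_fract_mult
        to_fract_diff k R_identity[OF k(1) nz(3,4,1,2)] flip: x2_def x3_def k_def q_def)
qed

lemma to_fract_Q_poly:
  "to_fract (Q_poly a b \<zeta>1 \<zeta>2 \<alpha>) =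
     to_fract (var_f * var_g * xi1 a b \<zeta>2 * xi2 a b \<zeta>1 * xi3 a b \<zeta>1 \<zeta>2)
     * wedge (eta1 a b \<zeta>1 \<zeta>2 \<alpha>) (eta2 a b \<zeta>1 \<zeta>2 \<alpha>)"
proof -
  have k: "to_fract (cst (\<alpha> + 1)) \<noteq> 0"
    "to_fract (cst (1 / (\<alpha> + 1))) = 1 / to_fract (cst (\<alpha> + 1))"
    using al by (auto simp: cst_inverse) (simp add: cst_def)
  have nz: "to_fract (xi1 a b \<zeta>2) \<noteq> 0" "to_fract (xi2 a b \<zeta>1) \<noteq> 0"
    "to_fract (xi3 a b \<zeta>1 \<zeta>2) \<noteq> 0"
    "to_fract (var_f :: real bpoly) \<noteq> 0" "to_fract (var_g :: real bpoly) \<noteq> 0"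
    using xi_nonzero[OF b z1 z2] var_nonzero by simp_all
  show ?thesis
    by (simp only: Q_poly_eq wedge_def eta1_eq eta2_eq fst_conv snd_conv P_fun_def S_fun_def
        to_fract_mult to_fract_diff k Q_identity[OF k(1) nz(4,5,1,2,3)])
qed

lemma to_fract_R_poly:
  "to_fract (R_poly a b \<zeta>1 \<zeta>2 \<alpha>) =
     to_fract (var_f * var_g * xi2 a b \<zeta>1 * xi3 a b \<zeta>1 \<zeta>2)
     * wedge (dform (Q_poly a b \<zeta>1 \<zeta>2 \<alpha>)) (eta2 a b \<zeta>1 \<zeta>2 \<alpha>)"
proof -
  have k: "to_fract (cst (\<alpha> + 1)) \<noteq> 0"
    "to_fract (cst (1 / (\<alpha> + 1))) = 1 / to_fract (cst (\<alpha> + 1))"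
    using al by (auto simp: cst_inverse) (simp add: cst_def)
  have nz: "to_fract (xi2 a b \<zeta>1) \<noteq> 0" "to_fract (xi3 a b \<zeta>1 \<zeta>2) \<noteq> 0"
    "to_fract (var_f :: real bpoly) \<noteq> 0" "to_fract (var_g :: real bpoly) \<noteq> 0"
    using xi_nonzero[OF b z1 z2] var_nonzero by simp_all
  show ?thesis
    by (simp only: R_poly_eq wedge_def dform_def eta2_eq fst_conv snd_conv P_fun_def S_fun_def
        to_fract_mult to_fract_diff k R_identity[OF k(1) nz(3,4,1,2)])
qed

end

lemma vanishes_at_iff:
  assumes "r * to_fract q = to_fract p" "eval2 q z \<noteq> 0"
  shows "vanishes_at r z \<longleftrightarrow> eval2 p z = 0"
proof -
  have q: "q \<noteq> 0" using assms(2) by auto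
  have "p' * q = p * q'" if "r = Fract p' q'" "eval2 q' z \<noteq> 0" for p' q'
  proof -
    have "q' \<noteq> 0" using that(2) by auto
    with assms(1) that(1) q show ?thesis
      by (auto simp: to_fract_def eq_fract algebra_simps)
  qed
  hence "eval2 p' z * eval2 q z = eval2 p z * eval2 q' z"
    if "r = Fract p' q'" "eval2 q' z \<noteq> 0" for p' q'
    using that by (metis eval2_simps(3))
  moreover have "r = Fract p q"
    using assms(1) q by (cases r) (auto simp: to_fract_def eq_fract algebra_simps)
  ultimately show ?thesis
    unfolding vanishes_at_def using assms(2) by (metis mult_eq_0_iff)
qed

lemma form_zero_eta2_iff:
  fixes a b \<zeta>1 \<zeta>2 \<alpha> x y :: real
  assumes "b \<noteq> 0" "\<zeta>1 > 0" "\<zeta>2 > 0" "\<alpha> > 0" "x \<noteq> 0" "y \<noteq> 0"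
  defines "X2 \<equiv> (\<lambda>y. ((a - 1) * y - \<zeta>1)^2 + b^2 * y^2)"
    and "X3 \<equiv> (\<lambda>x. ((a - 1) * \<zeta>2 * x + a * \<zeta>1)^2 + b^2 * (\<zeta>2 * x + \<zeta>1)^2)"
  shows "form_zero (eta2 a b \<zeta>1 \<zeta>2 \<alpha>) (x, y) \<longleftrightarrow>
     - 1 / ((\<alpha> + 1) * x) + deriv X3 x / X3 x = 0 \<and> 1 / ((\<alpha> + 1) * y) - deriv X2 y / X2 y = 0"
proof -
  let ?x2 = "xi2 a b \<zeta>1" and ?x3 = "xi3 a b \<zeta>1 \<zeta>2" and ?k = "cst (\<alpha> + 1) :: real bpoly"
  have k: "?k \<noteq> 0" using assms by (simp add: cst_def)
  note nz = xi_nonzero[OF assms(1-3)] var_nonzero k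
  have X2: "X2 y \<noteq> 0"
    using assms(1,2,6) by (auto simp: X2_def sum_power2_eq_zero_iff simp flip: power_mult_distrib)
  have X3: "X3 x \<noteq> 0"
  proof
    assume "X3 x = 0"
    hence "(a - 1) * \<zeta>2 * x + a * \<zeta>1 = 0" "\<zeta>2 * x + \<zeta>1 = 0"
      using assms(1) by (auto simp: X3_def sum_power2_eq_zero_iff simp flip: power_mult_distrib)
    hence "\<zeta>2 * x = 0" by algebra
    with assms(3,5) show False by simp
  qed
  have dX2: "deriv X2 y = eval2 (diff_g ?x2) (x, y)"
    unfolding X2_def by (rule DERIV_imp_deriv, (rule derivative_eq_intros refl)+)
      (simp add: diff_g_def xi2_def cst_def var_g_def eval2_def power2_eq_square pderiv_pCons
        algebra_simps)
  have dX3: "deriv X3 x = eval2 (diff_f ?x3) (x, y)"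
    unfolding X3_def by (rule DERIV_imp_deriv, (rule derivative_eq_intros refl)+)
      (simp add: diff_f_def xi3_def cst_def var_f_def eval2_def power2_eq_square pderiv_pCons
        map_poly_pCons algebra_simps)
  have e3: "eval2 (?k * var_f * ?x3) (x, y) \<noteq> 0"
    using X3 assms(4,5,6) by (simp add: eval2_xi3 X3_def)
  have "vanishes_at (P_fun a b \<zeta>1 \<zeta>2 \<alpha>) (x, y) \<longleftrightarrow>
      eval2 (?k * var_f * diff_f ?x3 - ?x3) (x, y) = 0"
    by (rule vanishes_at_iff[where q = "?k * var_f * ?x3"])
      (use nz e3 in \<open>auto simp: P_fun_def field_simps\<close>)
  also have "\<dots> \<longleftrightarrow> - 1 / ((\<alpha> + 1) * x) + deriv X3 x / X3 x = 0"
  proof -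
    have "eval2 ?x3 (x, y) = X3 x" by (simp add: eval2_xi3 X3_def)
    moreover have "\<alpha> + 1 \<noteq> 0" using assms(4) by simp
    ultimately show ?thesis using assms(5) X3 by (simp add: dX3 divide_simps) argo
  qed
  finally have P: "vanishes_at (P_fun a b \<zeta>1 \<zeta>2 \<alpha>) (x, y) \<longleftrightarrow> \<dots>" .
  have e2: "eval2 (?k * var_g * ?x2) (x, y) \<noteq> 0"
    using X2 assms(4,5,6) by (simp add: eval2_xi2 X2_def)
  have "vanishes_at (S_fun a b \<zeta>1 \<alpha>) (x, y) \<longleftrightarrow>
      eval2 (?x2 - ?k * var_g * diff_g ?x2) (x, y) = 0"
    by (rule vanishes_at_iff[where q = "?k * var_g * ?x2"])
      (use nz e2 in \<open>auto simp: S_fun_def field_simps\<close>)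
  also have "\<dots> \<longleftrightarrow> 1 / ((\<alpha> + 1) * y) - deriv X2 y / X2 y = 0"
  proof -
    have "eval2 ?x2 (x, y) = X2 y" by (simp add: eval2_xi2 X2_def)
    moreover have "\<alpha> + 1 \<noteq> 0" using assms(4) by simp
    ultimately show ?thesis using assms(6) X2 by (simp add: dX2 divide_simps) argo
  qed
  finally show ?thesis using P by (simp add: form_zero_def eta2_eq)
qed

end

theory Submission
  imports Defs
begin

text \<open>
  Write \<open>\<eta>\<^sub>2 = dH\<close> with \<open>H = A(f) + B(g)\<close>. On a quadrant \<open>A\<close> has a strict minimum and \<open>B\<close> a strict maximum, at
  the coordinates of \<open>p\<close>, so \<open>p\<close> is a saddle of \<open>H\<close>, and the zeros of \<open>R\<close> on \<open>\<Gamma>\<close> are the critical points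
  of \<open>H\<close> restricted to \<open>\<Gamma>\<close>. All edges of the Newton polygon of \<open>Q\<close> carry definite forms, so \<open>\<Gamma>\<close> is compact
  in the quadrant and the component through \<open>p\<close> is compact and isolated. It cannot stay in
  \<open>{H \<ge> H(p)}\<close>: its part in the half plane right of \<open>p\<close> would be a compact piece of a regular level set
  touching the vertical line through \<open>p\<close> only at \<open>p\<close>, yet \<open>Q\<close> changes sign there along this line, which a
  path around the piece forbids. Likewise it cannot stay in \<open>{H \<le> H(p)}\<close>. Thus the maximum and the
  minimum of \<open>H\<close> on the component are two critical points besides \<open>p\<close>. If the second derivative of \<open>H\<close>
  along the component is positive at \<open>p\<close>, the component enters both sectors of \<open>{H > H(p)}\<close>, left and
  right of \<open>p\<close>, and each contains a maximum; the negative case is symmetric. If it is zero, \<open>Q = 0\<close>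
  and \<open>R = 0\<close> are tangent at \<open>p\<close>, which then counts twice.
\<close>


section \<open>Level curves in the plane\<close>

text \<open>A winding argument in place of the Jordan curve theorem. A continuous argument of a
  nonvanishing plane-valued function on \<open>D\<close> lies above its value at \<open>p\<close>
  where \<open>q > 0\<close> near \<open>p\<close>, and below it where \<open>q < 0\<close>. A
  connected set reaching \<open>p\<close> from both sides therefore takes that value itself, which
  happens only on \<open>K\<close>.\<close>

lemma no_sign_change_off_level_component:
  fixes D K L :: "'a::euclidean_space set" and q :: "'a \<Rightarrow> real"
  assumes D: "convex D" and q: "continuous_on D q"
    and K: "compact K" and L: "closed L" and KL: "K \<inter> L = {}"
    and zeros: "{z\<in>D. q z = 0} \<subseteq> K \<union> L"
    and C: "connected C" "C \<subseteq> D - K"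
    and p: "p \<in> D" "p \<in> K" "q p = 0"
    and pos: "p \<in> closure {z\<in>C. q z > 0}" and neg: "p \<in> closure {z\<in>C. q z < 0}"
  shows False
proof -
  have "K \<noteq> UNIV" using K compact_imp_bounded not_bounded_UNIV by blast
  then obtain e where e: "e \<notin> K" by blast
  \<comment> \<open>\<open>infdist z {} = 0\<close>, so \<open>L\<close> is made nonempty.\<close>
  define L' where "L' = insert e L"
  \<comment> \<open>\<open>F\<close> has no zero on the convex set \<open>D\<close> and meets the positive real axis exactly on \<open>K\<close>, so
    its continuous argument crosses a multiple of \<open>2\<pi>\<close> only on \<open>K\<close>.\<close>
  define F where "F = (\<lambda>z. Complex (infdist z L' - infdist z K) (q z))"
  have cl: "closed L'" "L' \<noteq> {}" "closed K" "K \<noteq> {}"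
    using L K p by (auto simp: L'_def compact_imp_closed)
  have K0: "infdist z K = 0 \<longleftrightarrow> z \<in> K" and L0: "infdist z L' = 0 \<longleftrightarrow> z \<in> L'" for z
    using cl by (auto simp: in_closed_iff_infdist_zero)
  have KL': "K \<inter> L' = {}" using KL e by (auto simp: L'_def)
  have "continuous_on D F"
    unfolding F_def Complex_eq by (intro continuous_intros q)
  moreover have "F z \<noteq> 0" if "z \<in> D" for z
  proof
    assume "F z = 0"
    hence z: "q z = 0" "infdist z L' = infdist z K" by (auto simp: F_def complex_eq_iff)
    with zeros that have "z \<in> K \<union> L'" by (auto simp: L'_def)
    with z(2) K0 L0 KL' show False by (metis Int_iff UnE empty_iff)
  qed
  ultimately obtain g where g: "continuous_on D g" "\<And>z. z \<in> D \<Longrightarrow> F z = exp (g z)"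
    using continuous_logarithm_on_contractible[OF _ convex_imp_contractible[OF D]] by metis
  define \<theta> where "\<theta> = (\<lambda>z. Im (g z))"
  have \<theta>: "continuous_on D \<theta>" unfolding \<theta>_def by (intro continuous_intros g)
  have qz: "q z = exp (Re (g z)) * sin (\<theta> z)"
    and dz: "infdist z L' - infdist z K = exp (Re (g z)) * cos (\<theta> z)" if "z \<in> D" for z
    using arg_cong[OF g(2)[OF that], of Im] arg_cong[OF g(2)[OF that], of Re]
    by (simp_all add: F_def \<theta>_def Im_exp Re_exp)
  have sp: "sin (\<theta> p) = 0" using qz[OF p(1)] p(3) by simp
  have "infdist p L' > 0" using L0[of p] KL' p(2) infdist_nonneg[of p L'] by auto
  hence "cos (\<theta> p) > 0" using dz[OF p(1)] K0 p(2) by (simp add: zero_less_mult_iff)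
  hence cp: "cos (\<theta> p) = 1" using sp sin_cos_squared_add[of "\<theta> p"] by (simp add: power2_eq_1_iff)
  have ne: "\<theta> z \<noteq> \<theta> p" if "z \<in> C" for z
  proof
    assume eq: "\<theta> z = \<theta> p"
    have z: "z \<in> D" "z \<notin> K" using that C by auto
    have "q z = 0" using qz[OF z(1)] eq sp by simp
    hence "z \<in> L'" using zeros z by (auto simp: L'_def)
    hence "infdist z L' = 0" using L0 by simp
    moreover have "infdist z L' - infdist z K > 0" using dz[OF z(1)] eq cp by simp
    ultimately show False using infdist_nonneg[of z K] by linarith
  qed
  \<comment> \<open>Within distance \<open>pi\<close> of \<open>\<theta> p\<close> the sign of the
    sine, and so the sign of \<open>q\<close>, tells on which side of \<open>\<theta> p\<close> the
    argument lies.\<close>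
  obtain d where d: "d > 0" "\<And>z. z \<in> D \<Longrightarrow> dist z p < d \<Longrightarrow> \<bar>\<theta> z - \<theta> p\<bar> < pi"
    using \<theta> p(1) pi_gt_zero unfolding continuous_on_iff dist_real_def by metis
  have sgn: "sin (\<theta> z - \<theta> p) = sin (\<theta> z)" for z by (simp add: sin_diff sp cp)
  obtain z1 where z1: "z1 \<in> C" "q z1 > 0" "dist z1 p < d"
    using pos d(1) unfolding closure_approachable by blast
  obtain z2 where z2: "z2 \<in> C" "q z2 < 0" "dist z2 p < d"
    using neg d(1) unfolding closure_approachable by blast
  have zD: "z1 \<in> D" "z2 \<in> D" using z1 z2 C by auto
  have "\<theta> z1 > \<theta> p"
  proof (rule ccontr)
    assume "\<not> ?thesis"
    hence "0 \<le> \<theta> p - \<theta> z1" "\<theta> p - \<theta> z1 \<le> pi" using d(2)[OF zD(1) z1(3)] by auto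
    hence "sin (\<theta> p - \<theta> z1) \<ge> 0" by (rule sin_ge_zero)
    moreover have "sin (\<theta> z1) > 0" using qz[OF zD(1)] z1(2) by (simp add: zero_less_mult_iff)
    ultimately show False using sgn[of z1] sin_minus[of "\<theta> z1 - \<theta> p"] by simp
  qed
  moreover have "\<theta> z2 < \<theta> p"
  proof (rule ccontr)
    assume "\<not> ?thesis"
    hence "0 \<le> \<theta> z2 - \<theta> p" "\<theta> z2 - \<theta> p \<le> pi" using d(2)[OF zD(2) z2(3)] by auto
    hence "sin (\<theta> z2 - \<theta> p) \<ge> 0" by (rule sin_ge_zero)
    moreover have "sin (\<theta> z2) < 0" using qz[OF zD(2)] z2(2) by (simp add: mult_less_0_iff)
    ultimately show False using sgn[of z2] by simp
  qed
  moreover have "connected (\<theta> ` C)"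
    using C \<theta> by (intro connected_continuous_image) (auto intro: continuous_on_subset)
  ultimately have "\<theta> p \<in> \<theta> ` C"
    using z1(1) z2(1) connectedD_interval[of "\<theta> ` C" "\<theta> z2" "\<theta> z1" "\<theta> p"] by auto
  then obtain z where "z \<in> C" "\<theta> z = \<theta> p" by (metis imageE)
  with ne show False by blast
qed

section \<open>Implicit functions and Lagrange multipliers in the plane\<close>

lemma MVT_unordered:
  fixes f :: "real \<Rightarrow> real"
  assumes "\<And>t. \<bar>t - a\<bar> \<le> \<bar>b - a\<bar> \<Longrightarrow> (f has_real_derivative f' t) (at t)"
  shows "\<exists>t. \<bar>t - a\<bar> \<le> \<bar>b - a\<bar> \<and> f b - f a = (b - a) * f' t"
proof (cases a b rule: linorder_cases)
  case less
  obtain t where "t > a" "t < b" "f b - f a = (b - a) * f' t"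
    using MVT2[OF less, of f f'] assms less by force
  thus ?thesis by (intro exI[of _ t]) auto
next
  case greater
  obtain t where "t > b" "t < a" "f a - f b = (a - b) * f' t"
    using MVT2[OF greater, of f f'] assms greater by force
  thus ?thesis by (intro exI[of _ t]) (auto simp: algebra_simps)
qed auto

lemma continuous_on_swap [continuous_intros]:
  "continuous_on S (prod.swap :: 'a::topological_space \<times> 'b::topological_space \<Rightarrow> _)"
  unfolding prod.swap_def[abs_def] by (intro continuous_intros)

lemma open_swap_vimage:
  fixes N :: "('a::topological_space \<times> 'b::topological_space) set"
  assumes "open N" shows "open (prod.swap -` N)"
  using assms by (intro open_vimage continuous_on_swap)

locale C1_plane =
  fixes q qx qy :: "real \<times> real \<Rightarrow> real"
  assumes q_deriv: "\<And>z. (q has_derivative (\<lambda>h. qx z * fst h + qy z * snd h)) (at z)"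
    and qx_cont: "continuous_on UNIV qx" and qy_cont: "continuous_on UNIV qy"
begin

lemma q_cont: "continuous_on S q"
  by (intro continuous_at_imp_continuous_on ballI has_derivative_continuous[OF q_deriv])

lemma q_deriv_x: "((\<lambda>x. q (x, y)) has_real_derivative qx (x, y)) (at x)"
proof -
  have "((\<lambda>x. (x, y)) has_derivative (\<lambda>h. (h, 0))) (at x)"
    by (auto intro!: derivative_eq_intros)
  from has_derivative_compose[OF this q_deriv] show ?thesis
    by (simp add: has_field_derivative_def mult.commute[of _ "qx (x, y)"] cong: if_cong)
qed

lemma q_deriv_y: "((\<lambda>y. q (x, y)) has_real_derivative qy (x, y)) (at y)"
proof -
  have "((\<lambda>y. (x, y)) has_derivative (\<lambda>h. (0, h))) (at y)"
    by (auto intro!: derivative_eq_intros)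
  from has_derivative_compose[OF this q_deriv] show ?thesis
    by (simp add: has_field_derivative_def mult.commute[of _ "qx (x, y)"] cong: if_cong)
qed

text \<open>Lets statements proved by solving for the second coordinate cover points where
  \<open>qy\<close> vanishes but \<open>qx\<close> does not.\<close>

lemma C1_plane_swap:
  "C1_plane (\<lambda>z. q (prod.swap z)) (\<lambda>z. qy (prod.swap z)) (\<lambda>z. qx (prod.swap z))"
proof
  have sw: "continuous_on UNIV (prod.swap :: real \<times> real \<Rightarrow> _)"
    unfolding prod.swap_def[abs_def] by (intro continuous_intros)
  show "continuous_on UNIV (\<lambda>z. qy (prod.swap z))" "continuous_on UNIV (\<lambda>z. qx (prod.swap z))"
    using continuous_on_compose2[OF qy_cont sw] continuous_on_compose2[OF qx_cont sw] by auto
  fix z :: "real \<times> real"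
  have "(prod.swap has_derivative prod.swap) (at z)"
    unfolding prod.swap_def[abs_def]
    by (intro has_derivative_Pair has_derivative_fst has_derivative_snd has_derivative_ident)
  from has_derivative_compose[OF this q_deriv]
  show "((\<lambda>z. q (prod.swap z)) has_derivative
      (\<lambda>h. qy (prod.swap z) * fst h + qx (prod.swap z) * snd h)) (at z)"
    by (simp add: add.commute)
qed

lemma C1_plane_uminus: "C1_plane (\<lambda>z. - q z) (\<lambda>z. - qx z) (\<lambda>z. - qy z)"
proof
  show "continuous_on UNIV (\<lambda>z. - qx z)" "continuous_on UNIV (\<lambda>z. - qy z)"
    by (intro continuous_on_minus qx_cont qy_cont)+
  show "((\<lambda>z. - q z) has_derivative (\<lambda>h. - qx z * fst h + - qy z * snd h)) (at z)" for z
    using has_derivative_minus[OF q_deriv[of z]] by (simp add: algebra_simps)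
qed

text \<open>Implicit function theorem where \<open>qy > 0\<close>. On a box \<open>q\<close>
  increases strictly in \<open>y\<close>, so each vertical segment carries at most one zero, and the
  opposite signs on the bottom and top edges provide one. Continuity comes from compactness of the
  graph, the slope from mean value points.\<close>

lemma local_graph_pos:
  assumes q0: "q (x0, y0) = 0" and qy0: "qy (x0, y0) > 0" and W: "open W" "(x0, y0) \<in> W"
  shows "\<exists>\<phi> d e. d > 0 \<and> e > 0 \<and> \<phi> x0 = y0
      \<and> (\<forall>x. \<bar>x - x0\<bar> \<le> d \<longrightarrow> \<bar>\<phi> x - y0\<bar> \<le> e \<and> q (x, \<phi> x) = 0)
      \<and> (\<forall>x y. \<bar>x - x0\<bar> \<le> d \<longrightarrow> \<bar>y - y0\<bar> \<le> e \<longrightarrow> q (x, y) = 0 \<longrightarrow> y = \<phi> x)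
      \<and> {x0-d..x0+d} \<times> {y0-e..y0+e} \<subseteq> W
      \<and> continuous_on {x0-d..x0+d} \<phi>
      \<and> (\<phi> has_real_derivative - qx (x0, y0) / qy (x0, y0)) (at x0)"
proof -
  have "open (W \<inter> {z. qy z > 0})"
    by (intro open_Int W open_Collect_less continuous_intros qy_cont)
  then obtain r where r: "r > 0" "ball (x0, y0) r \<subseteq> W \<inter> {z. qy z > 0}"
    using W qy0 openE[of "W \<inter> {z. qy z > 0}" "(x0, y0)"] by auto
  define e where "e = r / 3"
  have e: "e > 0" using r by (simp add: e_def)
  have box: "(x, y) \<in> W" "qy (x, y) > 0" if "\<bar>x - x0\<bar> \<le> e" "\<bar>y - y0\<bar> \<le> e" for x y
  proof -
    have "dist (x0, y0) (x, y) \<le> \<bar>x - x0\<bar> + \<bar>y - y0\<bar>"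
      unfolding dist_Pair_Pair dist_real_def using sqrt_sum_squares_le_sum_abs[of "x0 - x" "y0 - y"]
      by (simp add: abs_minus_commute)
    also have "\<dots> < r" using that r by (simp add: e_def)
    finally show "(x, y) \<in> W" "qy (x, y) > 0" using r by auto
  qed
  have mono: "q (x, y) < q (x, y')"
    if "\<bar>x - x0\<bar> \<le> e" "\<bar>y - y0\<bar> \<le> e" "\<bar>y' - y0\<bar> \<le> e" "y < y'" for x y y'
    using that(4)
  proof (rule DERIV_pos_imp_increasing)
    fix t assume "y \<le> t" "t \<le> y'"
    hence "\<bar>t - y0\<bar> \<le> e" using that by auto
    thus "\<exists>l. ((\<lambda>y. q (x, y)) has_real_derivative l) (at t) \<and> l > 0"
      using q_deriv_y box(2)[OF that(1)] by blast
  qed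
  have ends: "q (x0, y0 - e) < 0" "q (x0, y0 + e) > 0"
    using mono[of x0 "y0 - e" y0] mono[of x0 y0 "y0 + e"] e q0 by auto
  have nhdslim: "((\<lambda>x. q (x, y)) \<longlongrightarrow> q (x0, y)) (nhds x0)" for y
    using DERIV_isCont[OF q_deriv_x[of y x0]]
    unfolding isCont_def by (rule iffD1[OF tendsto_at_iff_tendsto_nhds])
  have "eventually (\<lambda>x. q (x, y0 - e) < 0 \<and> q (x, y0 + e) > 0) (nhds x0)"
    by (intro eventually_conj order_tendstoD[OF nhdslim] ends)
  then obtain d' where d': "d' > 0"
    "\<And>x. dist x x0 < d' \<Longrightarrow> q (x, y0 - e) < 0 \<and> q (x, y0 + e) > 0"
    unfolding eventually_nhds_metric by blast
  define d where "d = min e (d' / 2)"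
  have d: "d > 0" "d \<le> e" using e d' by (auto simp: d_def)
  have "\<exists>y. \<bar>y - y0\<bar> \<le> e \<and> q (x, y) = 0" if "\<bar>x - x0\<bar> \<le> d" for x
  proof -
    have "q (x, y0 - e) < 0" "q (x, y0 + e) > 0"
      using d'(2)[of x] that d'(1) by (auto simp: dist_real_def d_def)
    moreover have "continuous_on {y0-e..y0+e} (\<lambda>y. q (x, y))"
      by (intro continuous_at_imp_continuous_on ballI DERIV_isCont[OF q_deriv_y])
    ultimately obtain y where "y \<ge> y0 - e" "y \<le> y0 + e" "q (x, y) = 0"
      using IVT'[of "\<lambda>y. q (x, y)" "y0 - e" 0 "y0 + e"] e by auto
    thus ?thesis by (intro exI[of _ y]) auto
  qed
  then obtain \<phi> where \<phi>: "\<And>x. \<bar>x - x0\<bar> \<le> d \<Longrightarrow> \<bar>\<phi> x - y0\<bar> \<le> e \<and> q (x, \<phi> x) = 0" by metis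
  have uniq: "y = \<phi> x" if "\<bar>x - x0\<bar> \<le> d" "\<bar>y - y0\<bar> \<le> e" "q (x, y) = 0" for x y
  proof -
    have "\<bar>x - x0\<bar> \<le> e" using that d by simp
    thus ?thesis
      using mono[of x y "\<phi> x"] mono[of x "\<phi> x" y] \<phi>[OF that(1)] that
      by (cases y "\<phi> x" rule: linorder_cases) auto
  qed
  have \<phi>0: "\<phi> x0 = y0" using uniq[of x0 y0] q0 d e by simp
  \<comment> \<open>The graph as a compact set of zeros on which \<open>fst\<close> is injective;
    the inverse of a continuous injection on a compact set is continuous.\<close>
  define G where "G = ({x0-d..x0+d} \<times> {y0-e..y0+e}) \<inter> {z. q z = 0}"
  have "compact G"
    unfolding G_def by (intro compact_Int_closed compact_Times compact_Icc closed_Collect_eq q_cont continuous_intros)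
  moreover have "\<forall>z\<in>G. (fst z, \<phi> (fst z)) = z"
  proof
    fix z assume "z \<in> G"
    hence "\<bar>fst z - x0\<bar> \<le> d" "\<bar>snd z - y0\<bar> \<le> e" "q (fst z, snd z) = 0"
      by (auto simp: G_def abs_le_iff)
    from uniq[OF this] show "(fst z, \<phi> (fst z)) = z" by (simp add: prod_eq_iff)
  qed
  ultimately have "continuous_on (fst ` G) (\<lambda>x. (x, \<phi> x))"
    by (intro continuous_on_inv continuous_intros) auto
  moreover have "fst ` G = {x0-d..x0+d}"
  proof
    show "{x0-d..x0+d} \<subseteq> fst ` G"
    proof
      fix x assume "x \<in> {x0-d..x0+d}"
      hence "(x, \<phi> x) \<in> G" using \<phi>[of x] by (auto simp: G_def abs_le_iff)
      thus "x \<in> fst ` G" by force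
    qed
  qed (auto simp: G_def)
  ultimately have "continuous_on {x0-d..x0+d} (\<lambda>x. (x, \<phi> x))" by simp
  from continuous_on_snd[OF this] have cont\<phi>: "continuous_on {x0-d..x0+d} \<phi>" by simp
  have "isCont \<phi> x0"
    using cont\<phi> d continuous_on_interior[of "{x0-d..x0+d}" \<phi> x0] by (simp add: interior_atLeastAtMost_real)
  hence \<phi>lim: "(\<phi> \<longlongrightarrow> y0) (at x0)" using \<phi>0 by (simp add: isCont_def)
  \<comment> \<open>Going from \<open>(x0, y0)\<close> horizontally to \<open>(x, y0)\<close> and
    then vertically to \<open>(x, \<phi> x)\<close>, the two increments of \<open>q\<close> cancel;
    each is a partial derivative at a mean value point times a step.\<close>
  have "\<exists>t s. \<bar>t - x0\<bar> \<le> \<bar>x - x0\<bar> \<and> \<bar>s - y0\<bar> \<le> \<bar>\<phi> x - y0\<bar>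
      \<and> qy (x, s) * (\<phi> x - y0) + qx (t, y0) * (x - x0) = 0" if x: "\<bar>x - x0\<bar> \<le> d" for x
  proof -
    obtain t where t: "\<bar>t - x0\<bar> \<le> \<bar>x - x0\<bar>" "q (x, y0) - q (x0, y0) = (x - x0) * qx (t, y0)"
      using MVT_unordered[of x0 x "\<lambda>x. q (x, y0)" "\<lambda>x. qx (x, y0)"] q_deriv_x by blast
    obtain s where s: "\<bar>s - y0\<bar> \<le> \<bar>\<phi> x - y0\<bar>"
      "q (x, \<phi> x) - q (x, y0) = (\<phi> x - y0) * qy (x, s)"
      using MVT_unordered[of y0 "\<phi> x" "\<lambda>y. q (x, y)" "\<lambda>y. qy (x, y)"] q_deriv_y by blast
    show ?thesis using t s \<phi>[OF x] q0 by (intro exI[of _ t] exI[of _ s]) (auto simp: algebra_simps)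
  qed
  then obtain t s where ts: "\<And>x. \<bar>x - x0\<bar> \<le> d \<Longrightarrow> \<bar>t x - x0\<bar> \<le> \<bar>x - x0\<bar>
      \<and> \<bar>s x - y0\<bar> \<le> \<bar>\<phi> x - y0\<bar> \<and> qy (x, s x) * (\<phi> x - y0) + qx (t x, y0) * (x - x0) = 0"
    by metis
  have near: "eventually (\<lambda>x. \<bar>x - x0\<bar> \<le> d \<and> x \<noteq> x0) (at x0)"
    unfolding eventually_at using d by (intro exI[of _ d]) (auto simp: dist_real_def)
  have idlim: "((\<lambda>x. x) \<longlongrightarrow> x0) (at x0)" by (rule tendsto_ident_at)
  have tlim: "(t \<longlongrightarrow> x0) (at x0)"
    by (rule Lim_transform_bound[of _ "\<lambda>x. x - x0", THEN LIM_zero_cancel])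
      (use near ts idlim in \<open>auto intro!: tendsto_eq_intros elim!: eventually_mono\<close>)
  have slim: "(s \<longlongrightarrow> y0) (at x0)"
    by (rule Lim_transform_bound[of _ "\<lambda>x. \<phi> x - y0", THEN LIM_zero_cancel])
      (use near ts \<phi>lim in \<open>auto intro!: tendsto_eq_intros elim!: eventually_mono\<close>)
  have "((\<lambda>x. qx (t x, y0)) \<longlongrightarrow> qx (x0, y0)) (at x0)"
    by (rule isCont_tendsto_compose[of _ qx])
      (use qx_cont in \<open>auto simp: continuous_on_eq_continuous_at intro!: tendsto_intros tlim\<close>)
  moreover have "((\<lambda>x. qy (x, s x)) \<longlongrightarrow> qy (x0, y0)) (at x0)"
    by (rule isCont_tendsto_compose[of _ qy])
      (use qy_cont in \<open>auto simp: continuous_on_eq_continuous_at intro!: tendsto_intros slim\<close>)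
  ultimately have "((\<lambda>x. - qx (t x, y0) / qy (x, s x)) \<longlongrightarrow> - qx (x0, y0) / qy (x0, y0)) (at x0)"
    using qy0 by (intro tendsto_intros) auto
  moreover have "eventually (\<lambda>x. - qx (t x, y0) / qy (x, s x) = (\<phi> x - \<phi> x0) / (x - x0)) (at x0)"
    using near
  proof eventually_elim
    case (elim x)
    have "\<bar>s x - y0\<bar> \<le> e" using ts[of x] \<phi>[of x] elim by linarith
    hence "qy (x, s x) > 0" using box(2)[of x "s x"] elim d by auto
    moreover have "qy (x, s x) * (\<phi> x - y0) + qx (t x, y0) * (x - x0) = 0" using ts[of x] elim by blast
    ultimately show ?case using elim \<phi>0 by (simp add: divide_simps) (simp add: algebra_simps)
  qed
  ultimately have "(\<phi> has_real_derivative - qx (x0, y0) / qy (x0, y0)) (at x0)"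
    unfolding has_field_derivative_iff by (rule Lim_transform_eventually)
  note \<phi>_deriv = this
  have sub: "{x0-d..x0+d} \<times> {y0-e..y0+e} \<subseteq> W"
  proof (clarify)
    fix x y assume "x \<in> {x0-d..x0+d}" "y \<in> {y0-e..y0+e}"
    hence "\<bar>x - x0\<bar> \<le> e" "\<bar>y - y0\<bar> \<le> e" using d by (auto simp: abs_le_iff)
    thus "(x, y) \<in> W" by (rule box(1))
  qed
  show ?thesis
  proof (rule exI[of _ \<phi>], rule exI[of _ d], rule exI[of _ e], intro conjI allI impI)
    show "\<bar>\<phi> x - y0\<bar> \<le> e" "q (x, \<phi> x) = 0" if "\<bar>x - x0\<bar> \<le> d" for x
      using \<phi>[OF that] by simp_all
    show "y = \<phi> x" if "\<bar>x - x0\<bar> \<le> d" "\<bar>y - y0\<bar> \<le> e" "q (x, y) = 0" for x y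
      using that by (rule uniq)
  qed (fact d(1) e \<phi>0 cont\<phi> \<phi>_deriv sub)+
qed

lemma local_graph:
  assumes q0: "q (x0, y0) = 0" and qy0: "qy (x0, y0) \<noteq> 0" and W: "open W" "(x0, y0) \<in> W"
  obtains \<phi> d e where "d > 0" "e > 0" "\<phi> x0 = y0"
    "\<And>x. \<bar>x - x0\<bar> \<le> d \<Longrightarrow> q (x, \<phi> x) = 0" "\<And>x. \<bar>x - x0\<bar> \<le> d \<Longrightarrow> (x, \<phi> x) \<in> W"
    "\<And>x y. \<bar>x - x0\<bar> \<le> d \<Longrightarrow> \<bar>y - y0\<bar> \<le> e \<Longrightarrow> q (x, y) = 0 \<Longrightarrow> y = \<phi> x"
    "continuous_on {x0-d..x0+d} \<phi>"
    "(\<phi> has_real_derivative - qx (x0, y0) / qy (x0, y0)) (at x0)"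
proof -
  interpret minus: C1_plane "\<lambda>z. - q z" "\<lambda>z. - qx z" "\<lambda>z. - qy z" by (rule C1_plane_uminus)
  have "\<exists>\<phi> d e. d > 0 \<and> e > 0 \<and> \<phi> x0 = y0
      \<and> (\<forall>x. \<bar>x - x0\<bar> \<le> d \<longrightarrow> \<bar>\<phi> x - y0\<bar> \<le> e \<and> q (x, \<phi> x) = 0)
      \<and> (\<forall>x y. \<bar>x - x0\<bar> \<le> d \<longrightarrow> \<bar>y - y0\<bar> \<le> e \<longrightarrow> q (x, y) = 0 \<longrightarrow> y = \<phi> x)
      \<and> {x0-d..x0+d} \<times> {y0-e..y0+e} \<subseteq> W
      \<and> continuous_on {x0-d..x0+d} \<phi>
      \<and> (\<phi> has_real_derivative - qx (x0, y0) / qy (x0, y0)) (at x0)"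
  proof (cases "qy (x0, y0) > 0")
    case True
    with q0 W show ?thesis by (intro local_graph_pos)
  next
    case False
    with qy0 have "- qy (x0, y0) > 0" by simp
    from minus.local_graph_pos[OF _ this W] q0 show ?thesis by simp
  qed
  then obtain \<phi> d e where *: "d > 0" "e > 0" "\<phi> x0 = y0"
    "\<And>x. \<bar>x - x0\<bar> \<le> d \<Longrightarrow> \<bar>\<phi> x - y0\<bar> \<le> e \<and> q (x, \<phi> x) = 0"
    "\<And>x y. \<bar>x - x0\<bar> \<le> d \<Longrightarrow> \<bar>y - y0\<bar> \<le> e \<Longrightarrow> q (x, y) = 0 \<Longrightarrow> y = \<phi> x"
    "{x0-d..x0+d} \<times> {y0-e..y0+e} \<subseteq> W" "continuous_on {x0-d..x0+d} \<phi>"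
    "(\<phi> has_real_derivative - qx (x0, y0) / qy (x0, y0)) (at x0)"
    by metis
  have "(x, \<phi> x) \<in> W" if "\<bar>x - x0\<bar> \<le> d" for x
  proof -
    have "x \<in> {x0-d..x0+d}" "\<phi> x \<in> {y0-e..y0+e}" using that *(4)[OF that] by (auto simp: abs_le_iff)
    thus ?thesis using *(6) by blast
  qed
  with *(4) show thesis by (intro that[OF *(1-3) _ _ *(5,7,8)]) auto
qed

text \<open>\<open>T\<close> is the local graph over a closed interval. It is kept apart from
  \<open>N\<close> because the facts obtained from \<open>local_graph\<close> do not confine the
  graph to the open box.\<close>

lemma zero_set_locally_connected_graph:
  assumes z: "q z = 0" "qy z \<noteq> 0" and W: "open W" "z \<in> W"
  shows "\<exists>N T. open N \<and> z \<in> N \<and> connected T \<and> {w\<in>N. q w = 0} \<subseteq> T \<and> T \<subseteq> {w\<in>W. q w = 0}"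
proof -
  obtain x0 y0 where z_eq: "z = (x0, y0)" by (cases z)
  obtain \<phi> d e where g: "d > 0" "e > 0" "\<phi> x0 = y0"
    "\<And>x. \<bar>x - x0\<bar> \<le> d \<Longrightarrow> q (x, \<phi> x) = 0" "\<And>x. \<bar>x - x0\<bar> \<le> d \<Longrightarrow> (x, \<phi> x) \<in> W"
    "\<And>x y. \<bar>x - x0\<bar> \<le> d \<Longrightarrow> \<bar>y - y0\<bar> \<le> e \<Longrightarrow> q (x, y) = 0 \<Longrightarrow> y = \<phi> x"
    "continuous_on {x0-d..x0+d} \<phi>"
    by (rule local_graph[OF z[unfolded z_eq] W(1) W(2)[unfolded z_eq]]) (rule that)
  define T where "T = (\<lambda>x. (x, \<phi> x)) ` {x0-d..x0+d}"
  define N where "N = {x0-d<..<x0+d} \<times> {y0-e<..<y0+e}"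
  have "connected T"
    unfolding T_def by (intro connected_continuous_image continuous_on_Pair g continuous_on_id) simp
  moreover have "open N" "z \<in> N" using g by (auto simp: N_def z_eq open_Times)
  moreover have "{w\<in>N. q w = 0} \<subseteq> T"
  proof
    fix w assume w: "w \<in> {w\<in>N. q w = 0}"
    hence "\<bar>fst w - x0\<bar> \<le> d" "\<bar>snd w - y0\<bar> \<le> e" "q (fst w, snd w) = 0"
      by (auto simp: N_def abs_le_iff)
    from g(6)[OF this] have "w = (\<lambda>x. (x, \<phi> x)) (fst w)" by (simp add: prod_eq_iff)
    moreover have "fst w \<in> {x0-d..x0+d}" using w by (auto simp: N_def)
    ultimately show "w \<in> T" unfolding T_def by (rule image_eqI)
  qed
  moreover have "T \<subseteq> {w\<in>W. q w = 0}"
    using g(4,5) by (auto simp: T_def abs_le_iff)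
  ultimately show ?thesis by (intro exI[of _ N] exI[of _ T]) simp
qed

text \<open>Along the local graph of the zero set \<open>h\<close> becomes a function of
  \<open>x\<close> alone with a local maximum, and its derivative there is
  \<open>hx + hy * m\<close> with the slope \<open>m = - qx / qy\<close>.\<close>

lemma lagrange_graph:
  assumes z: "q z = 0" "qy z \<noteq> 0" and N: "open N" "z \<in> N"
    and h: "(h has_derivative (\<lambda>v. hx * fst v + hy * snd v)) (at z)"
    and max: "\<And>w. w \<in> N \<Longrightarrow> q w = 0 \<Longrightarrow> h w \<le> h z"
  shows "qx z * hy = qy z * hx"
proof -
  obtain x0 y0 where z_eq: "z = (x0, y0)" by (cases z)
  define m where "m = - qx (x0, y0) / qy (x0, y0)"
  obtain \<phi> d where g: "d > 0" "\<phi> x0 = y0"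
    "\<And>x. \<bar>x - x0\<bar> \<le> d \<Longrightarrow> q (x, \<phi> x) = 0" "\<And>x. \<bar>x - x0\<bar> \<le> d \<Longrightarrow> (x, \<phi> x) \<in> N"
    "(\<phi> has_real_derivative m) (at x0)"
    using local_graph[of x0 y0 N] z N unfolding z_eq m_def by metis
  have "((\<lambda>x. (x, \<phi> x)) has_derivative (\<lambda>t. (t, m * t))) (at x0)"
    using g(5) by (intro has_derivative_Pair has_derivative_ident) (simp add: has_field_derivative_def)
  from has_derivative_compose[OF this, of h "\<lambda>v. hx * fst v + hy * snd v"] h g(2)
  have "((\<lambda>x. h (x, \<phi> x)) has_derivative (\<lambda>t. hx * t + hy * (m * t))) (at x0)" by (simp add: z_eq)
  moreover have "(\<lambda>t. hx * t + hy * (m * t)) = (*) (hx + hy * m)" by (auto simp: algebra_simps)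
  ultimately have "((\<lambda>x. h (x, \<phi> x)) has_real_derivative hx + hy * m) (at x0)"
    by (simp add: has_field_derivative_def)
  hence "hx + hy * m = 0"
    by (rule DERIV_local_max[OF _ g(1)])
      (use g max in \<open>auto simp: z_eq abs_minus_commute\<close>)
  thus ?thesis using z by (simp add: m_def z_eq field_simps)
qed

lemma zero_set_locally_connected:
  assumes z: "q z = 0" "(qx z, qy z) \<noteq> (0, 0)" and W: "open W" "z \<in> W"
  shows "\<exists>N T. open N \<and> z \<in> N \<and> connected T \<and> {w\<in>N. q w = 0} \<subseteq> T \<and> T \<subseteq> {w\<in>W. q w = 0}"
proof (cases "qy z = 0")
  case False
  with assms show ?thesis by (intro zero_set_locally_connected_graph)
next
  case True
  interpret swap: C1_plane "\<lambda>z. q (prod.swap z)" "\<lambda>z. qy (prod.swap z)" "\<lambda>z. qx (prod.swap z)"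
    by (rule C1_plane_swap)
  from True z have "q (prod.swap (prod.swap z)) = 0" "qx (prod.swap (prod.swap z)) \<noteq> 0" by auto
  then obtain N T where NT: "open N" "prod.swap z \<in> N" "connected T" "{w\<in>N. q (prod.swap w) = 0} \<subseteq> T"
    "T \<subseteq> {w \<in> prod.swap -` W. q (prod.swap w) = 0}"
    using swap.zero_set_locally_connected_graph[of "prod.swap z" "prod.swap -` W"] W
    by (force intro: open_swap_vimage)
  have "w \<in> prod.swap ` T" if "w \<in> prod.swap -` N" "q w = 0" for w
    using that NT(4) by (intro image_eqI[of _ _ "prod.swap w"]) auto
  moreover have "connected (prod.swap ` T)"
    by (intro connected_continuous_image continuous_on_swap NT)
  ultimately show ?thesis using NT
    by (intro exI[of _ "prod.swap -` N"] exI[of _ "prod.swap ` T"]) (auto intro: open_swap_vimage)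
qed

text \<open>The multiplier condition in determinant form. Where both partial derivatives of
  \<open>q\<close> vanish, both sides are 0; elsewhere one coordinate can be solved for.\<close>

lemma lagrange:
  assumes z: "q z = 0" and N: "open N" "z \<in> N"
    and h: "(h has_derivative (\<lambda>v. hx * fst v + hy * snd v)) (at z)"
    and max: "\<And>w. w \<in> N \<Longrightarrow> q w = 0 \<Longrightarrow> h w \<le> h z"
  shows "qx z * hy = qy z * hx"
proof (cases "qy z = 0")
  case False
  from lagrange_graph[OF z this N h max] show ?thesis .
next
  case True
  show ?thesis
  proof (cases "qx z = 0")
    case False
  interpret swap: C1_plane "\<lambda>z. q (prod.swap z)" "\<lambda>z. qy (prod.swap z)" "\<lambda>z. qx (prod.swap z)"
    by (rule C1_plane_swap)
    have sw: "(prod.swap has_derivative prod.swap) (at (prod.swap z))"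
      unfolding prod.swap_def[abs_def]
      by (intro has_derivative_Pair has_derivative_fst has_derivative_snd has_derivative_ident)
    have "((\<lambda>w. h (prod.swap w)) has_derivative (\<lambda>v. hy * fst v + hx * snd v)) (at (prod.swap z))"
      using has_derivative_compose[OF sw, of h "\<lambda>v. hx * fst v + hy * snd v"] h by (simp add: add.commute)
    hence "qy (prod.swap (prod.swap z)) * hx = qx (prod.swap (prod.swap z)) * hy"
      by (intro swap.lagrange_graph[where N = "prod.swap -` N"] open_swap_vimage N)
        (use z False N max in auto)
    thus ?thesis by simp
  qed (use True in simp)
qed

text \<open>Near a regular point all zeros lie on one connected arc through it, hence in its
  component. So \<open>Orb\<close> is relatively open in the compact zero set, and the rest of that
  set is closed.\<close>

lemma component_isolated:
  assumes U: "open U" and comp: "compact {z\<in>U. q z = 0}"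
    and Orb: "Orb = connected_component_set {z\<in>U. q z = 0} p"
    and reg: "\<And>z. z \<in> Orb \<Longrightarrow> (qx z, qy z) \<noteq> (0, 0)"
  shows "compact Orb" "closed ({z\<in>U. q z = 0} - Orb)"
proof -
  let ?G = "{z\<in>U. q z = 0}"
  show "compact Orb"
    unfolding Orb by (rule closedin_compact[OF comp closedin_connected_component])
  have sub: "Orb \<subseteq> ?G" unfolding Orb by (rule connected_component_subset)
  have "\<exists>N. open N \<and> z \<in> N \<and> N \<inter> ?G \<subseteq> Orb" if z: "z \<in> Orb" for z
  proof -
    have zG: "q z = 0" "z \<in> U" using sub z by auto
    obtain N T where NT: "open N" "z \<in> N" "connected T" "{w\<in>N. q w = 0} \<subseteq> T" "T \<subseteq> ?G"
      using zero_set_locally_connected[OF zG(1) reg[OF z] U zG(2)] by (elim exE conjE) (rule that)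
    have "z \<in> T" using subsetD[OF NT(4), of z] NT(2) zG(1) by simp
    hence "T \<subseteq> connected_component_set ?G z" using NT by (intro connected_component_maximal)
    also have "\<dots> = Orb" using z connected_component_eq[of z ?G p] by (simp add: Orb)
    finally have "{w\<in>N. q w = 0} \<subseteq> Orb" using NT(4) by (rule order_trans[rotated])
    moreover have "N \<inter> ?G \<subseteq> {w\<in>N. q w = 0}" by blast
    ultimately have "N \<inter> ?G \<subseteq> Orb" by (rule order_trans[rotated])
    with NT(1,2) show ?thesis by (intro exI[of _ N] conjI)
  qed
  then obtain N where N: "\<And>z. z \<in> Orb \<Longrightarrow> open (N z) \<and> z \<in> N z \<and> N z \<inter> ?G \<subseteq> Orb" by metis
  have "?G - Orb = ?G - (\<Union>z\<in>Orb. N z)"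
  proof
    show "?G - Orb \<subseteq> ?G - (\<Union>z\<in>Orb. N z)"
    proof
      fix w assume w: "w \<in> ?G - Orb"
      have "w \<notin> N z" if "z \<in> Orb" for z
        using N[OF that] w subsetD[of "N z \<inter> ?G" Orb w] by auto
      with w show "w \<in> ?G - (\<Union>z\<in>Orb. N z)" by simp
    qed
    show "?G - (\<Union>z\<in>Orb. N z) \<subseteq> ?G - Orb"
      using N by (intro Diff_mono) auto
  qed
  moreover have "open (\<Union>z\<in>Orb. N z)" using N by (intro open_UN) simp
  ultimately show "closed (?G - Orb)" using closed_Diff[OF compact_imp_closed[OF comp]] by simp
qed

end

section \<open>Curves through a saddle\<close>

text \<open>A derivative of the form \<open>(x - x0) * w x\<close> with \<open>w > 0\<close> makes
  the function fall before \<open>x0\<close> and rise after it.\<close>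

lemma less_of_deriv_sign:
  fixes A w :: "real \<Rightarrow> real"
  assumes I: "is_interval I" "x0 \<in> I" "x \<in> I" "x \<noteq> x0"
    and A: "\<And>x. x \<in> I \<Longrightarrow> (A has_real_derivative (x - x0) * w x) (at x)"
    and w: "\<And>x. x \<in> I \<Longrightarrow> w x > 0"
  shows "A x0 < A x"
proof -
  have cont: "continuous_on {u..v} A" if "u \<in> I" "v \<in> I" for u v
    by (intro continuous_at_imp_continuous_on ballI DERIV_isCont[OF A])
      (use mem_is_interval_1_I[OF I(1) that] in simp)
  show ?thesis
  proof (cases "x0 < x")
    case True
    thus ?thesis
    proof (rule DERIV_pos_imp_increasing_open)
      fix t assume "x0 < t" "t < x"
      moreover from this have "t \<in> I" using mem_is_interval_1_I[OF I(1-3), of t] by simp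
      ultimately show "\<exists>l. (A has_real_derivative l) (at t) \<and> l > 0"
        by (intro exI[of _ "(t - x0) * w t"] conjI A mult_pos_pos w) auto
    qed (rule cont[OF I(2,3)])
  next
    case False
    with I have "x < x0" by simp
    thus ?thesis
    proof (rule DERIV_neg_imp_decreasing_open)
      fix t assume "x < t" "t < x0"
      moreover from this have "t \<in> I" using mem_is_interval_1_I[OF I(1,3,2), of t] by simp
      ultimately show "\<exists>l. (A has_real_derivative l) (at t) \<and> l < 0"
        by (intro exI[of _ "(t - x0) * w t"] conjI A mult_neg_pos w) auto
    qed (rule cont[OF I(3,2)])
  qed
qed

text \<open>\<open>w x0\<close> plays the part of the second derivative at \<open>x0\<close>. One
  application of L'Hopital's rule replaces a Taylor expansion, as \<open>w\<close> is only assumed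
  continuous there.\<close>

lemma second_order_quotient:
  fixes A w :: "real \<Rightarrow> real"
  assumes I: "open I" "x0 \<in> I"
    and A: "\<And>x. x \<in> I \<Longrightarrow> (A has_real_derivative (x - x0) * w x) (at x)"
    and w: "isCont w x0"
  shows "((\<lambda>x. (A x - A x0) / (x - x0)\<^sup>2) \<longlongrightarrow> w x0 / 2) (at x0)"
proof (rule lhopital)
  have evI: "eventually (\<lambda>x. x \<in> I) (at x0)" using I by (simp add: eventually_at_in_open')
  have ne: "eventually (\<lambda>x. x \<noteq> x0) (at x0)" by (simp add: eventually_at_filter)
  have "isCont A x0" by (rule DERIV_isCont[OF A[OF I(2)]])
  hence "(A \<longlongrightarrow> A x0) (at x0)" by (simp add: isCont_def)
  from tendsto_diff[OF this tendsto_const[of "A x0"]]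
  show "((\<lambda>x. A x - A x0) \<longlongrightarrow> 0) (at x0)" by simp
  show "((\<lambda>x. (x - x0)\<^sup>2) \<longlongrightarrow> 0) (at x0)" by (auto intro!: tendsto_eq_intros)
  show "eventually (\<lambda>x. (x - x0)\<^sup>2 \<noteq> 0) (at x0)" "eventually (\<lambda>x. 2 * (x - x0) \<noteq> 0) (at x0)"
    using ne by (auto elim: eventually_mono)
  show "eventually (\<lambda>x. ((\<lambda>x. A x - A x0) has_real_derivative (x - x0) * w x) (at x)) (at x0)"
    using evI by eventually_elim (auto intro!: derivative_eq_intros A)
  show "eventually (\<lambda>x. ((\<lambda>x. (x - x0)\<^sup>2) has_real_derivative 2 * (x - x0)) (at x)) (at x0)"
    by (intro always_eventually allI) (auto intro!: derivative_eq_intros)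
  have "((\<lambda>x. w x / 2) \<longlongrightarrow> w x0 / 2) (at x0)"
    using w by (intro tendsto_divide) (auto simp: isCont_def)
  moreover have "eventually (\<lambda>x. w x / 2 = (x - x0) * w x / (2 * (x - x0))) (at x0)"
    using ne by eventually_elim (simp add: divide_simps)
  ultimately show "((\<lambda>x. (x - x0) * w x / (2 * (x - x0))) \<longlongrightarrow> w x0 / 2) (at x0)"
    by (rule Lim_transform_eventually)
qed

text \<open>Provides room inside an open set beyond a compact part of it; the edges of a rectangle
  around the curve are placed there.\<close>

lemma compact_bounded_above_in_open:
  fixes S I :: "real set"
  assumes "compact S" "S \<subseteq> I" "open I" "S \<noteq> {}"
  shows "\<exists>x\<in>I. \<forall>s\<in>S. s < x"
proof -
  obtain m where m: "m \<in> S" "\<And>s. s \<in> S \<Longrightarrow> s \<le> m" using compact_attains_sup assms by metis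
  with assms obtain e where "e > 0" "ball m e \<subseteq> I" using openE by blast
  hence "m + e / 2 \<in> I" by (auto simp: dist_real_def)
  with m(2) \<open>e > 0\<close> show ?thesis by (intro bexI[of _ "m + e / 2"]) force+
qed

lemma compact_bounded_below_in_open:
  fixes S I :: "real set"
  assumes "compact S" "S \<subseteq> I" "open I" "S \<noteq> {}"
  shows "\<exists>x\<in>I. \<forall>s\<in>S. x < s"
proof -
  obtain m where m: "m \<in> S" "\<And>s. s \<in> S \<Longrightarrow> m \<le> s" using compact_attains_inf assms by metis
  with assms obtain e where "e > 0" "ball m e \<subseteq> I" using openE by blast
  hence "m - e / 2 \<in> I" by (auto simp: dist_real_def)
  with m(2) \<open>e > 0\<close> show ?thesis by (intro bexI[of _ "m - e / 2"]) force+
qed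

text \<open>\<open>A\<close> has a strict minimum at \<open>x0\<close> and \<open>B\<close> a strict
  maximum at \<open>y0\<close>, with \<open>w1 x0\<close> and \<open>w2 y0\<close> in the role of
  the second derivatives up to sign. \<open>L\<close> contains the zeros of \<open>q\<close> in
  \<open>I \<times> J\<close> outside \<open>Orb\<close> and is closed in the whole plane, so
  \<open>Orb\<close> has a neighbourhood free of other zeros.\<close>

locale curve_through_saddle = C1_plane q qx qy
  for q qx qy :: "real \<times> real \<Rightarrow> real" +
  fixes I J :: "real set" and x0 y0 :: real and A w1 B w2 :: "real \<Rightarrow> real"
    and Orb L :: "(real \<times> real) set"
  assumes I: "open I" "is_interval I" "x0 \<in> I" and J: "open J" "is_interval J" "y0 \<in> J"
    and A: "\<And>x. x \<in> I \<Longrightarrow> (A has_real_derivative (x - x0) * w1 x) (at x)"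
    and w1: "\<And>x. x \<in> I \<Longrightarrow> w1 x > 0" "isCont w1 x0"
    and B: "\<And>y. y \<in> J \<Longrightarrow> (B has_real_derivative - ((y - y0) * w2 y)) (at y)"
    and w2: "\<And>y. y \<in> J \<Longrightarrow> w2 y > 0" "isCont w2 y0"
    and Orb: "compact Orb" "Orb \<subseteq> {z\<in>I \<times> J. q z = 0}" "(x0, y0) \<in> Orb"
    and L: "closed L" "Orb \<inter> L = {}" "{z\<in>I \<times> J. q z = 0} \<subseteq> Orb \<union> L"
    and reg: "(qx (x0, y0), qy (x0, y0)) \<noteq> (0, 0)"
begin

definition H :: "real \<times> real \<Rightarrow> real" where "H z = A (fst z) + B (snd z)"

text \<open>The zeros of \<open>q\<close> at which the gradients of \<open>q\<close> and
  \<open>H\<close> are parallel. They range over all of \<open>I \<times> J\<close> and not only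
  over \<open>Orb\<close>, so as to match all solutions of \<open>Q = R = 0\<close> in the
  quadrant.\<close>

definition crit :: "(real \<times> real) set" where
  "crit = {z\<in>I \<times> J. q z = 0 \<and>
     qx z * - ((snd z - y0) * w2 (snd z)) = qy z * ((fst z - x0) * w1 (fst z))}"

lemma B_deriv': "y \<in> J \<Longrightarrow> ((\<lambda>y. - B y) has_real_derivative (y - y0) * w2 y) (at y)"
  using DERIV_minus[OF B] by simp

lemma B_less: "y \<in> J \<Longrightarrow> y \<noteq> y0 \<Longrightarrow> B y < B y0"
  using less_of_deriv_sign[OF J(2,3) _ _ B_deriv' w2(1), of y] by simp

lemma H_deriv:
  assumes "z \<in> I \<times> J"
  shows "(H has_derivative (\<lambda>v. (fst z - x0) * w1 (fst z) * fst v
     + - ((snd z - y0) * w2 (snd z)) * snd v)) (at z)"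
proof -
  have fs: "fst z \<in> I" "snd z \<in> J" using assms by auto
  have "((\<lambda>z. A (fst z)) has_derivative (\<lambda>v. (fst z - x0) * w1 (fst z) * fst v)) (at z)"
    by (rule has_derivative_compose[OF has_derivative_fst[OF has_derivative_ident]
          A[OF fs(1), unfolded has_field_derivative_def]])
  moreover have "((\<lambda>z. B (snd z)) has_derivative (\<lambda>v. - ((snd z - y0) * w2 (snd z)) * snd v)) (at z)"
    by (rule has_derivative_compose[OF has_derivative_snd[OF has_derivative_ident]
          B[OF fs(2), unfolded has_field_derivative_def]])
  ultimately show ?thesis unfolding H_def[abs_def] by (rule has_derivative_add)
qed

lemma H_cont: "continuous_on (I \<times> J) H"
  by (intro continuous_at_imp_continuous_on ballI has_derivative_continuous[OF H_deriv])

lemma open_IJ: "open (I \<times> J)" using I J by (intro open_Times)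

lemma Orb_iff:
  assumes "z \<in> I \<times> J - L" shows "z \<in> Orb \<longleftrightarrow> q z = 0"
proof
  show "q z = 0" if "z \<in> Orb" using that Orb(2) by auto
  show "z \<in> Orb" if "q z = 0" using that assms subsetD[OF L(3), of z] by simp
qed

lemma local_max_crit:
  assumes z: "z \<in> Orb" and N: "open N" "z \<in> N" "\<And>w. w \<in> N \<Longrightarrow> w \<in> Orb \<Longrightarrow> H w \<le> H z"
  shows "z \<in> crit"
proof -
  have z': "z \<in> I \<times> J" "q z = 0" "z \<notin> L" using z Orb(2) L(2) by auto
  have "qx z * - ((snd z - y0) * w2 (snd z)) = qy z * ((fst z - x0) * w1 (fst z))"
  proof (rule lagrange[OF z'(2) _ _ H_deriv[OF z'(1)]])
    show "open (N \<inter> (I \<times> J - L))" using N open_IJ L(1) by (intro open_Int open_Diff)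
    show "z \<in> N \<inter> (I \<times> J - L)" using N z' by simp
    show "H w \<le> H z" if "w \<in> N \<inter> (I \<times> J - L)" "q w = 0" for w
      using that N(3) Orb_iff by simp
  qed
  thus ?thesis using z' by (simp add: crit_def)
qed

lemma local_min_crit:
  assumes z: "z \<in> Orb" and N: "open N" "z \<in> N" "\<And>w. w \<in> N \<Longrightarrow> w \<in> Orb \<Longrightarrow> H z \<le> H w"
  shows "z \<in> crit"
proof -
  have z': "z \<in> I \<times> J" "q z = 0" "z \<notin> L" using z Orb(2) L(2) by auto
  have "qx z * - (- ((snd z - y0) * w2 (snd z))) = qy z * - ((fst z - x0) * w1 (fst z))"
  proof (rule lagrange[OF z'(2)])
    show "open (N \<inter> (I \<times> J - L))" using N open_IJ L(1) by (intro open_Int open_Diff)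
    show "z \<in> N \<inter> (I \<times> J - L)" using N z' by simp
    show "- H w \<le> - H z" if "w \<in> N \<inter> (I \<times> J - L)" "q w = 0" for w
      using that N(3) Orb_iff by simp
    show "((\<lambda>w. - H w) has_derivative (\<lambda>v. - ((fst z - x0) * w1 (fst z)) * fst v
     + - (- ((snd z - y0) * w2 (snd z))) * snd v)) (at z)"
      using has_derivative_minus[OF H_deriv[OF z'(1)]] by (simp add: algebra_simps)
  qed
  thus ?thesis using z' by (simp add: crit_def)
qed

lemma saddle_crit: "(x0, y0) \<in> crit"
  using Orb by (auto simp: crit_def)

lemma Orb_sub: "Orb \<subseteq> I \<times> J" using Orb(2) by blast

lemma H_attains:
  assumes K: "compact K" "K \<subseteq> Orb" "K \<noteq> {}"
  shows "\<exists>z\<in>K. \<forall>w\<in>K. H w \<le> H z" "\<exists>z\<in>K. \<forall>w\<in>K. H z \<le> H w"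
  using continuous_attains_sup[OF K(1,3), of H] continuous_attains_inf[OF K(1,3), of H]
    continuous_on_subset[OF H_cont, of K] K(2) Orb_sub by auto

text \<open>Otherwise the strict maximum of \<open>B\<close> lets \<open>Orb\<close> meet the
  vertical line through the saddle only at the saddle. A path around the right-hand part of
  \<open>Orb\<close> then joins the two sides of the saddle on this line, where \<open>q\<close> has
  opposite signs because \<open>qy\<close> is nonzero.\<close>

lemma exists_below:
  assumes qy0: "qy (x0, y0) \<noteq> 0"
  shows "\<exists>z\<in>Orb. H z < H (x0, y0)"
proof (rule ccontr)
  assume "\<not> ?thesis"
  hence above: "H z \<ge> H (x0, y0)" if "z \<in> Orb" for z using that by force
  define D where "D = (I \<inter> {x0..}) \<times> J"
  define K where "K = Orb \<inter> {z. fst z \<ge> x0}"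
  have line: "y = y0" if "(x0, y) \<in> Orb" for y
  proof (rule ccontr)
    assume "y \<noteq> y0"
    moreover have "y \<in> J" using subsetD[OF Orb_sub that] by simp
    ultimately show False using B_less[of y] above[OF that] by (simp add: H_def)
  qed
  have fI: "fst ` Orb \<subseteq> I" and sJ: "snd ` Orb \<subseteq> J" using Orb_sub by force+
  have cf: "compact (fst ` Orb)" and cs: "compact (snd ` Orb)"
    by (rule compact_continuous_image[OF _ Orb(1)]; intro continuous_intros)+
  have ne: "fst ` Orb \<noteq> {}" "snd ` Orb \<noteq> {}" using Orb(3) by blast+
  obtain X where X: "X \<in> I" "\<And>z. z \<in> Orb \<Longrightarrow> fst z < X"
    using compact_bounded_above_in_open[OF cf fI I(1) ne(1)] by auto
  obtain Y2 where Y2: "Y2 \<in> J" "\<And>z. z \<in> Orb \<Longrightarrow> snd z < Y2"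
    using compact_bounded_above_in_open[OF cs sJ J(1) ne(2)] by auto
  obtain Y1 where Y1: "Y1 \<in> J" "\<And>z. z \<in> Orb \<Longrightarrow> Y1 < snd z"
    using compact_bounded_below_in_open[OF cs sJ J(1) ne(2)] by auto
  have bounds: "x0 < X" "Y1 < y0" "y0 < Y2" using X(2) Y1(2) Y2(2) Orb(3) by force+
  \<comment> \<open>The path runs from just above the saddle upwards, to the right along the top,
    down the far side, back along the bottom and up to just below the saddle. The pieces
    \<open>C1\<close> and \<open>C5\<close> leave out the saddle itself.\<close>
  define C1 where "C1 = {x0} \<times> {y0<..Y2}"
  define C2 where "C2 = {x0..X} \<times> {Y2}"
  define C3 where "C3 = {X} \<times> {Y1..Y2}"
  define C4 where "C4 = {x0..X} \<times> {Y1}"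
  define C5 where "C5 = {x0} \<times> {Y1..<y0}"
  define C where "C = C1 \<union> C2 \<union> C3 \<union> C4 \<union> C5"
  have conn: "connected C1" "connected C2" "connected C3" "connected C4" "connected C5"
    unfolding C1_def C2_def C3_def C4_def C5_def by (intro connected_Times; simp)+
  have "(x0, Y2) \<in> C1 \<inter> C2" "(X, Y2) \<in> (C1 \<union> C2) \<inter> C3" "(X, Y1) \<in> (C1 \<union> C2 \<union> C3) \<inter> C4"
    "(x0, Y1) \<in> (C1 \<union> C2 \<union> C3 \<union> C4) \<inter> C5"
    using bounds by (auto simp: C1_def C2_def C3_def C4_def C5_def)
  hence "C1 \<inter> C2 \<noteq> {}" "(C1 \<union> C2) \<inter> C3 \<noteq> {}" "(C1 \<union> C2 \<union> C3) \<inter> C4 \<noteq> {}"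
    "(C1 \<union> C2 \<union> C3 \<union> C4) \<inter> C5 \<noteq> {}" by blast+
  hence "connected C" unfolding C_def by (intro connected_Un conn)
  have IX: "x \<in> I" if "x0 \<le> x" "x \<le> X" for x using mem_is_interval_1_I[OF I(2,3) X(1) that] .
  have JY: "y \<in> J" if "Y1 \<le> y" "y \<le> Y2" for y using mem_is_interval_1_I[OF J(2) Y1(1) Y2(1) that] .
  have "C \<subseteq> D - K"
  proof
    fix z assume z: "z \<in> C"
    obtain x y where xy: "z = (x, y)" by (cases z)
    have rect: "x0 \<le> x" "x \<le> X" "Y1 \<le> y" "y \<le> Y2"
      using z bounds by (auto simp: xy C_def C1_def C2_def C3_def C4_def C5_def)
    have "z \<notin> Orb"
    proof
      assume O: "z \<in> Orb"
      hence "x < X" "Y1 < y" "y < Y2" using X(2) Y1(2) Y2(2) by (force simp: xy)+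
      \<comment> \<open>\<open>Orb\<close> lies strictly inside the other three sides of the
        rectangle, so only the pieces on the line through the saddle remain.\<close>
      hence "x = x0" "y \<noteq> y0" using z by (auto simp: xy C_def C1_def C2_def C3_def C4_def C5_def)
      with O line show False by (simp add: xy)
    qed
    thus "z \<in> D - K" using rect IX JY by (simp add: xy D_def K_def)
  qed
  have zeros: "{z\<in>D. q z = 0} \<subseteq> K \<union> L"
  proof
    fix z assume "z \<in> {z\<in>D. q z = 0}"
    moreover from this have "z \<in> Orb \<union> L" using subsetD[OF L(3), of z] by (auto simp: D_def)
    ultimately show "z \<in> K \<union> L" by (auto simp: K_def D_def)
  qed
  have "compact K"
    unfolding K_def by (intro compact_Int_closed Orb closed_Collect_le continuous_intros)
  have "convex D"
    unfolding D_def using I J by (intro convex_Times convex_Int) (auto simp: is_interval_convex_1 convex_real_interval)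
  have pD: "(x0, y0) \<in> D" "(x0, y0) \<in> K" "q (x0, y0) = 0"
    using I J Orb by (auto simp: D_def K_def)
  \<comment> \<open>Multiplying by \<open>qy (x0, y0)\<close> turns the derivative along the line
    into a square, so one argument covers both signs of \<open>qy\<close>.\<close>
  have der: "((\<lambda>y. q (x0, y) * qy (x0, y0)) has_real_derivative qy (x0, y0) * qy (x0, y0)) (at y0)"
    by (intro DERIV_cmult_right q_deriv_y)
  have sq: "qy (x0, y0) * qy (x0, y0) > 0" using qy0 unfolding zero_less_mult_iff by linarith
  obtain d1 where d1: "d1 > 0" "\<And>h. 0 < h \<Longrightarrow> h < d1 \<Longrightarrow> q (x0, y0 + h) * qy (x0, y0) > 0"
    using DERIV_pos_inc_right[OF der sq] pD(3) by auto
  obtain d2 where d2: "d2 > 0" "\<And>h. 0 < h \<Longrightarrow> h < d2 \<Longrightarrow> q (x0, y0 - h) * qy (x0, y0) < 0"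
    using DERIV_pos_inc_left[OF der sq] pD(3) by auto
  have up: "(x0, y0) \<in> closure {z\<in>C. q z * qy (x0, y0) > 0}"
    unfolding closure_approachable
  proof (intro allI impI)
    fix e :: real assume e: "e > 0"
    define h where "h = min (min d1 e) (Y2 - y0) / 2"
    have h: "0 < h" "h < d1" "h < e" "h < Y2 - y0" using d1 d2 e bounds by (auto simp: h_def)
    show "\<exists>z\<in>{z\<in>C. q z * qy (x0, y0) > 0}. dist z (x0, y0) < e"
      by (rule bexI[of _ "(x0, y0 + h)"])
        (use h d1(2) in \<open>auto simp: C_def C1_def dist_Pair_Pair dist_real_def\<close>)
  qed
  have down: "(x0, y0) \<in> closure {z\<in>C. q z * qy (x0, y0) < 0}"
    unfolding closure_approachable
  proof (intro allI impI)
    fix e :: real assume e: "e > 0"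
    define h where "h = min (min d2 e) (y0 - Y1) / 2"
    have h: "0 < h" "h < d2" "h < e" "h < y0 - Y1" using d1 d2 e bounds by (auto simp: h_def)
    show "\<exists>z\<in>{z\<in>C. q z * qy (x0, y0) < 0}. dist z (x0, y0) < e"
      by (rule bexI[of _ "(x0, y0 - h)"])
        (use h d2(2) in \<open>auto simp: C_def C5_def dist_Pair_Pair dist_real_def\<close>)
  qed
  have KL: "K \<inter> L = {}" using L(2) by (auto simp: K_def)
  have cont: "continuous_on D (\<lambda>z. q z * qy (x0, y0))" by (intro continuous_intros q_cont)
  have zeros': "{z\<in>D. q z * qy (x0, y0) = 0} \<subseteq> K \<union> L" using zeros qy0 by simp
  show False
    by (rule no_sign_change_off_level_component[OF \<open>convex D\<close> cont \<open>compact K\<close> L(1) KL zeros'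
          \<open>connected C\<close> \<open>C \<subseteq> D - K\<close> pD(1,2) _ up down]) (simp add: pD)
qed

text \<open>Along the curve, a graph of slope \<open>m = - qx / qy\<close>, the increment of
  \<open>H\<close> divided by \<open>(x - x0)^2\<close> tends to
  \<open>(w1 x0 - w2 y0 * m^2) / 2\<close>, which is positive by \<open>gt\<close>.\<close>

lemma higher_nearby:
  assumes gt: "w1 x0 * (qy (x0, y0))\<^sup>2 > w2 y0 * (qx (x0, y0))\<^sup>2"
  shows "\<exists>\<phi>. eventually (\<lambda>x. (x, \<phi> x) \<in> Orb \<and> H (x, \<phi> x) > H (x0, y0)) (at x0)"
proof -
  have qy0: "qy (x0, y0) \<noteq> 0"
  proof
    assume "qy (x0, y0) = 0"
    with gt w2(1)[OF J(3)] show False by (simp add: mult_less_0_iff not_less)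
  qed
  have q0: "q (x0, y0) = 0" and W: "open (I \<times> J - L)" "(x0, y0) \<in> I \<times> J - L"
    using Orb open_IJ L by auto
  define m where "m = - qx (x0, y0) / qy (x0, y0)"
  obtain \<phi> d where g: "d > 0" "\<phi> x0 = y0"
    "\<And>x. \<bar>x - x0\<bar> \<le> d \<Longrightarrow> q (x, \<phi> x) = 0" "\<And>x. \<bar>x - x0\<bar> \<le> d \<Longrightarrow> (x, \<phi> x) \<in> I \<times> J - L"
    "(\<phi> has_real_derivative - qx (x0, y0) / qy (x0, y0)) (at x0)"
    by (rule local_graph[OF q0 qy0 W]) (rule that)
  have near: "eventually (\<lambda>x. \<bar>x - x0\<bar> \<le> d \<and> x \<noteq> x0) (at x0)"
    unfolding eventually_at using g(1) by (intro exI[of _ d]) (auto simp: dist_real_def)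
  \<comment> \<open>At \<open>y0\<close> the quotient would have the default value 0, so the limit
    is filled in instead: \<open>\<phi> x = y0\<close> may also occur at points \<open>x\<close>
    other than \<open>x0\<close>.\<close>
  define \<psi> where "\<psi> = (\<lambda>y. if y = y0 then - (w2 y0 / 2) else (B y - B y0) / (y - y0)\<^sup>2)"
  have "((\<lambda>y. ((- B y) - (- B y0)) / (y - y0)\<^sup>2) \<longlongrightarrow> w2 y0 / 2) (at y0)"
    by (rule second_order_quotient[OF J(1,3) B_deriv' w2(2)])
  from tendsto_minus[OF this]
  have "((\<lambda>y. (B y - B y0) / (y - y0)\<^sup>2) \<longlongrightarrow> - (w2 y0 / 2)) (at y0)"
    by (simp add: diff_divide_distrib)
  hence "(\<psi> \<longlongrightarrow> - (w2 y0 / 2)) (at y0)"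
    by (rule Lim_transform_eventually) (simp add: \<psi>_def eventually_at_filter)
  hence "isCont \<psi> y0" by (simp add: isCont_def \<psi>_def)
  moreover have \<phi>lim: "(\<phi> \<longlongrightarrow> y0) (at x0)"
    using DERIV_isCont[OF g(5)] g(2) by (simp add: isCont_def)
  ultimately have "((\<lambda>x. \<psi> (\<phi> x)) \<longlongrightarrow> \<psi> y0) (at x0)" by (rule isCont_tendsto_compose)
  moreover have "((\<lambda>x. (\<phi> x - y0) / (x - x0)) \<longlongrightarrow> m) (at x0)"
    using g(5) g(2) by (simp add: m_def has_field_derivative_iff)
  moreover have "((\<lambda>x. (A x - A x0) / (x - x0)\<^sup>2) \<longlongrightarrow> w1 x0 / 2) (at x0)"
    by (rule second_order_quotient[OF I(1,3) A w1(2)])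
  ultimately have "((\<lambda>x. (A x - A x0) / (x - x0)\<^sup>2 + \<psi> (\<phi> x) * ((\<phi> x - y0) / (x - x0))\<^sup>2)
      \<longlongrightarrow> w1 x0 / 2 + \<psi> y0 * m\<^sup>2) (at x0)"
    by (intro tendsto_add tendsto_mult tendsto_power)
  moreover have "w1 x0 / 2 + \<psi> y0 * m\<^sup>2 > 0"
    using gt qy0 by (simp add: \<psi>_def m_def power_divide field_simps)
  ultimately have "eventually (\<lambda>x. (A x - A x0) / (x - x0)\<^sup>2
      + \<psi> (\<phi> x) * ((\<phi> x - y0) / (x - x0))\<^sup>2 > 0) (at x0)"
    by (rule order_tendstoD)
  hence "eventually (\<lambda>x. (x, \<phi> x) \<in> Orb \<and> H (x, \<phi> x) > H (x0, y0)) (at x0)"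
    using near
  proof eventually_elim
    case (elim x)
    have "(x, \<phi> x) \<in> Orb" using Orb_iff[OF g(4)] g(3) elim by simp
    \<comment> \<open>This includes the case \<open>\<phi> x = y0\<close>, where both sides are
      0.\<close>
    have "\<psi> (\<phi> x) * (\<phi> x - y0)\<^sup>2 = B (\<phi> x) - B y0" by (simp add: \<psi>_def)
    hence "(A x - A x0) / (x - x0)\<^sup>2 + \<psi> (\<phi> x) * ((\<phi> x - y0) / (x - x0))\<^sup>2
        = (H (x, \<phi> x) - H (x0, y0)) / (x - x0)\<^sup>2"
      by (simp add: H_def power_divide add_divide_distrib[symmetric])
    hence "(H (x, \<phi> x) - H (x0, y0)) / (x - x0)\<^sup>2 > 0" using elim by simp
    hence "H (x, \<phi> x) > H (x0, y0)" by (simp add: zero_less_divide_iff)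
    with \<open>(x, \<phi> x) \<in> Orb\<close> show ?case by blast
  qed
  thus ?thesis by blast
qed

text \<open>The maximum of \<open>H\<close> over the part of \<open>Orb\<close> with
  \<open>fst z \<ge> x0\<close> exceeds \<open>H (x0, y0)\<close> because of the nearby higher
  points. On the line \<open>fst z = x0\<close> the values are at most \<open>H (x0, y0)\<close>, so
  the maximiser lies in the open half-plane and is a local maximum on all of
  \<open>Orb\<close>.\<close>

lemma exists_right:
  assumes "w1 x0 * (qy (x0, y0))\<^sup>2 > w2 y0 * (qx (x0, y0))\<^sup>2"
  shows "\<exists>z\<in>crit. fst z > x0 \<and> H z > H (x0, y0)"
proof -
  obtain \<phi> d where d: "d > 0"
    "\<And>x. x \<noteq> x0 \<Longrightarrow> dist x x0 < d \<Longrightarrow> (x, \<phi> x) \<in> Orb \<and> H (x, \<phi> x) > H (x0, y0)"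
    using higher_nearby[OF assms] unfolding eventually_at by auto
  define K where "K = Orb \<inter> {z. fst z \<ge> x0}"
  have "compact K"
    unfolding K_def by (intro compact_Int_closed Orb closed_Collect_le continuous_intros)
  moreover have w: "(x0 + d / 2, \<phi> (x0 + d / 2)) \<in> K" "H (x0 + d / 2, \<phi> (x0 + d / 2)) > H (x0, y0)"
    using d(2)[of "x0 + d / 2"] d(1) by (auto simp: K_def dist_real_def)
  moreover have "K \<subseteq> Orb" by (simp add: K_def)
  ultimately have "\<exists>z\<in>K. \<forall>w\<in>K. H w \<le> H z" using H_attains(1)[of K] by blast
  then obtain z where z: "z \<in> K" "\<And>w. w \<in> K \<Longrightarrow> H w \<le> H z" by blast
  have "H z > H (x0, y0)" using w(2) z(2)[OF w(1)] by simp
  note z = z this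
  have "fst z \<noteq> x0"
  proof
    assume "fst z = x0"
    moreover have "snd z \<in> J" using z(1) Orb_sub by (auto simp: K_def)
    ultimately show False using z(3) B_less[of "snd z"] by (cases "snd z = y0") (auto simp: H_def)
  qed
  hence "fst z > x0" using z(1) by (simp add: K_def)
  moreover have "z \<in> crit"
    by (rule local_max_crit[where N = "{z. fst z > x0}"])
      (use z \<open>fst z > x0\<close> in \<open>auto simp: K_def intro!: open_Collect_less continuous_intros\<close>)
  ultimately show ?thesis using z(3) by blast
qed

lemma exists_left:
  assumes "w1 x0 * (qy (x0, y0))\<^sup>2 > w2 y0 * (qx (x0, y0))\<^sup>2"
  shows "\<exists>z\<in>crit. fst z < x0 \<and> H z > H (x0, y0)"
proof -
  obtain \<phi> d where d: "d > 0"
    "\<And>x. x \<noteq> x0 \<Longrightarrow> dist x x0 < d \<Longrightarrow> (x, \<phi> x) \<in> Orb \<and> H (x, \<phi> x) > H (x0, y0)"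
    using higher_nearby[OF assms] unfolding eventually_at by auto
  define K where "K = Orb \<inter> {z. fst z \<le> x0}"
  have "compact K"
    unfolding K_def by (intro compact_Int_closed Orb closed_Collect_le continuous_intros)
  moreover have w: "(x0 - d / 2, \<phi> (x0 - d / 2)) \<in> K" "H (x0 - d / 2, \<phi> (x0 - d / 2)) > H (x0, y0)"
    using d(2)[of "x0 - d / 2"] d(1) by (auto simp: K_def dist_real_def)
  moreover have "K \<subseteq> Orb" by (simp add: K_def)
  ultimately have "\<exists>z\<in>K. \<forall>w\<in>K. H w \<le> H z" using H_attains(1)[of K] by blast
  then obtain z where z: "z \<in> K" "\<And>w. w \<in> K \<Longrightarrow> H w \<le> H z" by blast
  have "H z > H (x0, y0)" using w(2) z(2)[OF w(1)] by simp
  note z = z this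
  have "fst z \<noteq> x0"
  proof
    assume "fst z = x0"
    moreover have "snd z \<in> J" using z(1) Orb_sub by (auto simp: K_def)
    ultimately show False using z(3) B_less[of "snd z"] by (cases "snd z = y0") (auto simp: H_def)
  qed
  hence "fst z < x0" using z(1) by (simp add: K_def)
  moreover have "z \<in> crit"
    by (rule local_max_crit[where N = "{z. fst z < x0}"])
      (use z \<open>fst z < x0\<close> in \<open>auto simp: K_def intro!: open_Collect_less continuous_intros\<close>)
  ultimately show ?thesis using z(3) by blast
qed

text \<open>Exchanging the coordinates turns \<open>A + B\<close> into \<open>- B - A\<close>.
  Minima and maxima trade places, so each statement about critical points on one side of the saddle
  level yields one for the other side.\<close>

lemma swapped:
  "curve_through_saddle (\<lambda>z. q (prod.swap z)) (\<lambda>z. qy (prod.swap z)) (\<lambda>z. qx (prod.swap z))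
     J I y0 x0 (\<lambda>y. - B y) w2 (\<lambda>x. - A x) w1 (prod.swap ` Orb) (prod.swap -` L)"
proof (intro curve_through_saddle.intro curve_through_saddle_axioms.intro)
  show "C1_plane (\<lambda>z. q (prod.swap z)) (\<lambda>z. qy (prod.swap z)) (\<lambda>z. qx (prod.swap z))"
    by (rule C1_plane_swap)
  show "((\<lambda>x. - A x) has_real_derivative - ((x - x0) * w1 x)) (at x)" if "x \<in> I" for x
    using DERIV_minus[OF A[OF that]] .
  show "compact (prod.swap ` Orb)" by (intro compact_continuous_image continuous_on_swap Orb)
  show "prod.swap ` Orb \<subseteq> {z \<in> J \<times> I. q (prod.swap z) = 0}" using Orb(2) by auto
  show "(y0, x0) \<in> prod.swap ` Orb" using Orb(3) by force
  show "closed (prod.swap -` L)" by (intro closed_vimage L continuous_on_swap)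
  show "prod.swap ` Orb \<inter> prod.swap -` L = {}" using L(2) by auto
  show "{z \<in> J \<times> I. q (prod.swap z) = 0} \<subseteq> prod.swap ` Orb \<union> prod.swap -` L"
  proof
    fix z assume "z \<in> {z \<in> J \<times> I. q (prod.swap z) = 0}"
    hence "prod.swap z \<in> Orb \<union> L" by (intro subsetD[OF L(3)]) auto
    thus "z \<in> prod.swap ` Orb \<union> prod.swap -` L" by (force intro: image_eqI[of _ _ "prod.swap z"])
  qed
  show "(qy (prod.swap (y0, x0)), qx (prod.swap (y0, x0))) \<noteq> (0, 0)" using reg by auto
qed (use I J w1 w2 B_deriv' in \<open>simp_all\<close>)

lemma swapped_crit_iff:
  "z \<in> curve_through_saddle.crit (\<lambda>z. q (prod.swap z)) (\<lambda>z. qy (prod.swap z)) (\<lambda>z. qx (prod.swap z))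
     J I y0 x0 w2 w1 \<longleftrightarrow> prod.swap z \<in> crit"
proof -
  interpret sw: curve_through_saddle "\<lambda>z. q (prod.swap z)" "\<lambda>z. qy (prod.swap z)"
    "\<lambda>z. qx (prod.swap z)" J I y0 x0 "\<lambda>y. - B y" w2 "\<lambda>x. - A x" w1 "prod.swap ` Orb" "prod.swap -` L"
    by (rule swapped)
  show ?thesis by (cases z) (auto simp: sw.crit_def crit_def)
qed

lemma swapped_H: "curve_through_saddle.H (\<lambda>y. - B y) (\<lambda>x. - A x) z = - H (prod.swap z)"
proof -
  interpret sw: curve_through_saddle "\<lambda>z. q (prod.swap z)" "\<lambda>z. qy (prod.swap z)"
    "\<lambda>z. qx (prod.swap z)" J I y0 x0 "\<lambda>y. - B y" w2 "\<lambda>x. - A x" w1 "prod.swap ` Orb" "prod.swap -` L"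
    by (rule swapped)
  show ?thesis by (simp add: sw.H_def H_def)
qed

text \<open>If \<open>qy\<close> is nonzero, \<open>exists_below\<close> puts the global minimum of
  \<open>H\<close> on \<open>Orb\<close> below the saddle. If \<open>qy = 0\<close>, regularity
  makes \<open>qx\<close> nonzero; then the second-order inequality holds after exchanging the
  coordinates, and a higher critical point there is a lower one here.\<close>

lemma exists_crit_below: "\<exists>z\<in>crit. H z < H (x0, y0)"
proof (cases "qy (x0, y0) = 0")
  case False
  from exists_below[OF this] obtain w where w: "w \<in> Orb" "H w < H (x0, y0)" by blast
  have "\<exists>z\<in>Orb. \<forall>w\<in>Orb. H z \<le> H w" using H_attains(2)[OF Orb(1)] w(1) by blast
  then obtain z where z: "z \<in> Orb" "\<And>w. w \<in> Orb \<Longrightarrow> H z \<le> H w" by blast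
  have "z \<in> crit" by (rule local_min_crit[OF z(1), of UNIV]) (use z in auto)
  moreover have "H z < H (x0, y0)" using z(2)[OF w(1)] w(2) by simp
  ultimately show ?thesis by blast
next
  case True
  interpret sw: curve_through_saddle "\<lambda>z. q (prod.swap z)" "\<lambda>z. qy (prod.swap z)"
    "\<lambda>z. qx (prod.swap z)" J I y0 x0 "\<lambda>y. - B y" w2 "\<lambda>x. - A x" w1 "prod.swap ` Orb" "prod.swap -` L"
    by (rule swapped)
  have "w2 y0 * (qx (x0, y0))\<^sup>2 > 0" using True reg w2(1)[OF J(3)] by simp
  hence "w2 y0 * (qx (prod.swap (y0, x0)))\<^sup>2 > w1 x0 * (qy (prod.swap (y0, x0)))\<^sup>2" using True by simp
  from sw.exists_right[OF this] obtain z where "z \<in> sw.crit" "sw.H z > sw.H (y0, x0)" by blast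
  hence "prod.swap z \<in> crit" "H (prod.swap z) < H (x0, y0)"
    by (simp_all add: swapped_crit_iff swapped_H)
  thus ?thesis by blast
qed

lemma exists_crit_above: "\<exists>z\<in>crit. H (x0, y0) < H z"
proof -
  interpret sw: curve_through_saddle "\<lambda>z. q (prod.swap z)" "\<lambda>z. qy (prod.swap z)"
    "\<lambda>z. qx (prod.swap z)" J I y0 x0 "\<lambda>y. - B y" w2 "\<lambda>x. - A x" w1 "prod.swap ` Orb" "prod.swap -` L"
    by (rule swapped)
  obtain z where "z \<in> sw.crit" "sw.H z < sw.H (y0, x0)" using sw.exists_crit_below by blast
  hence "prod.swap z \<in> crit" "H (x0, y0) < H (prod.swap z)"
    by (simp_all add: swapped_crit_iff swapped_H)
  thus ?thesis by blast
qed

lemma three_points: assumes "finite crit" shows "card crit \<ge> 3"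
proof -
  obtain z1 z2 where z: "z1 \<in> crit" "z2 \<in> crit" "H z1 < H (x0, y0)" "H (x0, y0) < H z2"
    using exists_crit_below exists_crit_above by blast
  have "card {(x0, y0), z1, z2} = 3" using z by (auto simp: card_insert_if)
  moreover have "{(x0, y0), z1, z2} \<subseteq> crit" using z saddle_crit by simp
  ultimately show ?thesis using card_mono[OF assms] by metis
qed

lemma four_points_aux:
  assumes "finite crit" and gt: "w1 x0 * (qy (x0, y0))\<^sup>2 > w2 y0 * (qx (x0, y0))\<^sup>2"
  shows "card crit \<ge> 4"
proof -
  obtain z1 where z1: "z1 \<in> crit" "H z1 < H (x0, y0)" using exists_crit_below by blast
  obtain z2 where z2: "z2 \<in> crit" "fst z2 > x0" "H z2 > H (x0, y0)" using exists_right[OF gt] by blast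
  obtain z3 where z3: "z3 \<in> crit" "fst z3 < x0" "H z3 > H (x0, y0)" using exists_left[OF gt] by blast
  have "z2 \<noteq> z3" using z2(2) z3(2) by auto
  hence "card {(x0, y0), z1, z2, z3} = 4" using z1 z2(3) z3(3) by (auto simp: card_insert_if)
  moreover have "{(x0, y0), z1, z2, z3} \<subseteq> crit" using z1 z2 z3 saddle_crit by simp
  ultimately show ?thesis using card_mono[OF assms(1)] by metis
qed

text \<open>\<open>w1 x0 * qy^2 - w2 y0 * qx^2\<close> is the second derivative of \<open>H\<close>
  at the saddle along the tangent vector \<open>(- qy, qx)\<close>. If it is negative, exchanging
  the coordinates makes it positive.\<close>

lemma four_points:
  assumes fin: "finite crit" and ne: "w1 x0 * (qy (x0, y0))\<^sup>2 \<noteq> w2 y0 * (qx (x0, y0))\<^sup>2"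
  shows "card crit \<ge> 4"
proof (cases "w1 x0 * (qy (x0, y0))\<^sup>2 > w2 y0 * (qx (x0, y0))\<^sup>2")
  case True
  from four_points_aux[OF fin this] show ?thesis .
next
  case False
  interpret sw: curve_through_saddle "\<lambda>z. q (prod.swap z)" "\<lambda>z. qy (prod.swap z)"
    "\<lambda>z. qx (prod.swap z)" J I y0 x0 "\<lambda>y. - B y" w2 "\<lambda>x. - A x" w1 "prod.swap ` Orb" "prod.swap -` L"
    by (rule swapped)
  have inj: "inj_on prod.swap S" for S :: "(real \<times> real) set" by (rule inj_on_inverseI[of _ prod.swap]) simp
  have "sw.crit = prod.swap ` crit"
  proof (intro set_eqI iffI)
    fix z assume "z \<in> sw.crit"
    hence "prod.swap z \<in> crit" by (simp add: swapped_crit_iff)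
    thus "z \<in> prod.swap ` crit" by (intro image_eqI[of _ _ "prod.swap z"]) simp
  next
    fix z assume "z \<in> prod.swap ` crit"
    thus "z \<in> sw.crit" by (auto simp: swapped_crit_iff)
  qed
  hence "card sw.crit = card crit" "finite sw.crit" using fin inj by (simp_all add: card_image)
  moreover have "w2 y0 * (qx (prod.swap (y0, x0)))\<^sup>2 > w1 x0 * (qy (prod.swap (y0, x0)))\<^sup>2"
    using False ne by simp
  ultimately show ?thesis using sw.four_points_aux by simp
qed

end

section \<open>Intersection multiplicities\<close>

text \<open>Since fixing \<open>g\<close> at a constant commutes with differentiation in
  \<open>f\<close>, the rules for \<open>pderiv\<close> on one-variable polynomials carry over to
  \<open>diff_f\<close>.\<close>

lemma poly_map_pderiv_const: "poly (map_poly pderiv p) [:y:] = pderiv (poly p [:y:])"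
  for p :: "'a::idom poly poly"
  by (induction p) (simp_all add: map_poly_pCons pderiv_add pderiv_mult pderiv_pCons pderiv_smult)

lemma eval2_diff_f: "eval2 (diff_f p) z = poly (pderiv (poly p [:snd z:])) (fst z)"
  by (simp add: eval2_def diff_f_def poly_map_pderiv_const)

lemma eval2_diff_f_mult:
  "eval2 (diff_f (p * q)) z = eval2 (diff_f p) z * eval2 q z + eval2 p z * eval2 (diff_f q) z"
  by (simp add: eval2_diff_f pderiv_mult) (simp add: eval2_def algebra_simps)

lemma eval2_diff_f_add [simp]: "eval2 (diff_f (p + q)) z = eval2 (diff_f p) z + eval2 (diff_f q) z"
  by (simp add: eval2_diff_f pderiv_add)

lemma eval2_diff_g_mult:
  "eval2 (diff_g (p * q)) z = eval2 (diff_g p) z * eval2 q z + eval2 p z * eval2 (diff_g q) z"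
  by (simp add: diff_g_def pderiv_mult algebra_simps)

lemma eval2_diff_g_add [simp]: "eval2 (diff_g (p + q)) z = eval2 (diff_g p) z + eval2 (diff_g q) z"
  by (simp add: diff_g_def pderiv_add)

lemma eval2_diff_power2:
  "eval2 (diff_f (p\<^sup>2)) z = 2 * eval2 p z * eval2 (diff_f p) z"
  "eval2 (diff_g (p\<^sup>2)) z = 2 * eval2 p z * eval2 (diff_g p) z"
  by (simp_all add: power2_eq_square eval2_diff_f_mult eval2_diff_g_mult)

lemma eval2_diff_minus [simp]:
  "eval2 (diff_f (p - q)) z = eval2 (diff_f p) z - eval2 (diff_f q) z"
  "eval2 (diff_g (p - q)) z = eval2 (diff_g p) z - eval2 (diff_g q) z"
  by (simp_all add: eval2_diff_f diff_g_def pderiv_diff)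

lemma diff_cst [simp]: "diff_f (cst c) = 0" "diff_g (cst c) = 0"
  by (simp_all add: diff_f_def diff_g_def cst_def map_poly_pCons pderiv_pCons)

lemma eval2_diff_var [simp]:
  "eval2 (diff_f var_f) z = 1" "eval2 (diff_g var_f) z = 0"
  "eval2 (diff_f var_g) z = 0" "eval2 (diff_g var_g) z = 1"
  by (simp_all add: diff_f_def diff_g_def var_f_def var_g_def eval2_def map_poly_pCons pderiv_pCons)

lemma eval2_1 [simp]: "eval2 1 z = 1"
  by (simp add: eval2_def)

lemma eval2_has_derivative:
  fixes p :: "real bpoly"
  shows "(eval2 p has_derivative (\<lambda>h. eval2 (diff_f p) z * fst h + eval2 (diff_g p) z * snd h)) (at z)"
proof (induction p)
  case 0
  show ?case by (simp add: eval2_def[abs_def] diff_f_def diff_g_def)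
next
  case (pCons c p)
  have e: "eval2 (pCons c p) = (\<lambda>z. poly c (fst z) + snd z * eval2 p z)"
    by (simp add: eval2_def fun_eq_iff)
  have df: "eval2 (diff_f (pCons c p)) z = poly (pderiv c) (fst z) + snd z * eval2 (diff_f p) z"
    by (simp add: eval2_def diff_f_def map_poly_pCons)
  have dg: "eval2 (diff_g (pCons c p)) z = eval2 p z + snd z * eval2 (diff_g p) z"
    by (simp add: eval2_def diff_g_def pderiv_pCons)
  have c: "((\<lambda>z. poly c (fst z)) has_derivative (\<lambda>h. poly (pderiv c) (fst z) * fst h)) (at z)"
    by (rule has_derivative_compose[OF has_derivative_fst[OF has_derivative_ident]
          poly_DERIV[unfolded has_field_derivative_def]])
  have "((\<lambda>z. poly c (fst z) + snd z * eval2 p z) has_derivative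
      (\<lambda>h. poly (pderiv c) (fst z) * fst h + (snd z * (eval2 (diff_f p) z * fst h + eval2 (diff_g p) z * snd h)
        + snd h * eval2 p z))) (at z)"
    by (intro has_derivative_add has_derivative_mult c pCons.IH has_derivative_snd has_derivative_ident)
  thus ?case unfolding e df dg by (simp add: algebra_simps)
qed

lemma eval2_continuous: "continuous_on S (eval2 p)" for p :: "real bpoly"
  by (intro continuous_at_imp_continuous_on ballI has_derivative_continuous[OF eval2_has_derivative])

section \<open>Complexification and lower bounds for intersection multiplicities\<close>

lemma eval2_complexify:
  "eval2 (complexify p) (of_real x, of_real y) = of_real (eval2 p (x, y))"
proof -
  have c: "poly (map_poly complex_of_real c) (of_real x) = of_real (poly c x)" for c
    by (induction c) (simp_all add: map_poly_pCons)
  have "poly (poly (map_poly (map_poly complex_of_real) p) [:of_real y:]) (of_real x) = of_real (poly (poly p [:y:]) x)"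
    by (induction p) (simp_all add: map_poly_pCons c)
  thus ?thesis by (simp add: eval2_def complexify_def)
qed

lemma diff_complexify: "diff_f (complexify p) = complexify (diff_f p)" "diff_g (complexify p) = complexify (diff_g p)"
proof -
  have "pderiv (map_poly complex_of_real c) = map_poly complex_of_real (pderiv c)" for c
    by (rule poly_eqI) (simp add: coeff_pderiv coeff_map_poly)
  thus "diff_f (complexify p) = complexify (diff_f p)"
    by (intro poly_eqI) (simp add: diff_f_def complexify_def coeff_map_poly)
  have h: "map_poly complex_of_real (of_nat n * c) = of_nat n * map_poly complex_of_real c" for n c
    by (rule poly_eqI) (simp add: coeff_map_poly of_nat_poly coeff_pCons mult_pCons_left split: nat.split)
  show "diff_g (complexify p) = complexify (diff_g p)"
    by (rule poly_eqI) (simp add: diff_g_def complexify_def coeff_pderiv coeff_map_poly h del: of_nat_Suc)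
qed

text \<open>Clearing both denominators gives a polynomial identity, at the price of a factor
  \<open>u\<close> that is a unit at \<open>z\<close>. Such an identity can be evaluated and
  differentiated at \<open>z\<close>.\<close>

lemma local_ideal_to_fractD:
  assumes "to_fract s \<in> local_ideal z F G"
  shows "\<exists>u a b. eval2 u z \<noteq> 0 \<and> s * u = a * F + b * G"
proof -
  from assms obtain p q p' q' where *: "to_fract s = Fract p q * to_fract F + Fract p' q' * to_fract G"
    "eval2 q z \<noteq> 0" "eval2 q' z \<noteq> 0"
    unfolding local_ideal_def local_ring_def by auto
  have nz: "q \<noteq> 0" "q' \<noteq> 0" using * by auto
  hence "Fract s 1 = Fract (p * F * q' + p' * G * q) (q * q')" using *(1) by (simp add: to_fract_def)
  hence "s * (q * q') = p * F * q' + p' * G * q" using nz by (simp add: eq_fract)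
  also have "\<dots> = (p * q') * F + (p' * q) * G" by (simp add: algebra_simps)
  finally show ?thesis using *(2,3) by (intro exI[of _ "q * q'"] exI[of _ "p * q'"] exI[of _ "p' * q"]) simp
qed

lemma to_fract_in_local_ring: "to_fract p \<in> local_ring z"
  unfolding local_ring_def to_fract_def by (intro CollectI exI[of _ p] exI[of _ 1]) simp

lemma intersection_mult_ge_card:
  assumes "finite B" "B \<subseteq> local_ring z" "indep_mod (local_ideal z F G) B"
  shows "intersection_mult F G z \<ge> enat (card B)"
  unfolding intersection_mult_def by (rule SUP_upper) (use assms in simp)

text \<open>At a common zero every polynomial in the local ideal vanishes, so nonzero constants stay
  outside it.\<close>

lemma intersection_mult_ge_1:
  assumes "eval2 F z = 0" "eval2 G z = 0"
  shows "intersection_mult F G z \<ge> 1"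
proof -
  have "indep_mod (local_ideal z F G) {1}"
    unfolding indep_mod_def
  proof (intro allI impI ballI)
    fix c s
    assume "(\<Sum>s\<in>{1}. to_fract (cst (c s)) * s) \<in> local_ideal z F G" and s: "s \<in> {1 :: 'a ratfun}"
    hence "to_fract (cst (c 1)) \<in> local_ideal z F G" by simp
    then obtain u a b where u: "eval2 u z \<noteq> 0" "cst (c 1) * u = a * F + b * G"
      using local_ideal_to_fractD by blast
    from arg_cong[OF u(2), of "\<lambda>p. eval2 p z"] assms u(1) s show "c s = 0" by simp
  qed
  from intersection_mult_ge_card[OF _ _ this] to_fract_in_local_ring[of 1 z]
  show ?thesis by (simp add: one_enat_def)
qed

text \<open>Evaluation at \<open>z\<close> and the derivative along \<open>(v, w)\<close> at
  \<open>z\<close> both vanish on the ideal, and together they determine a linear combination of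
  \<open>1\<close> and \<open>l\<close>. Hence these two are independent modulo the ideal.\<close>

lemma intersection_mult_ge_2_aux:
  assumes F: "eval2 F z = 0" and G: "eval2 G z = 0"
    and F': "v * eval2 (diff_f F) z + w * eval2 (diff_g F) z = 0"
    and G': "v * eval2 (diff_f G) z + w * eval2 (diff_g G) z = 0"
    and l: "v * eval2 (diff_f l) z + w * eval2 (diff_g l) z \<noteq> 0"
  shows "intersection_mult F G z \<ge> 2"
proof -
  \<comment> \<open>Ensures that \<open>{1, to_fract l}\<close> has two elements.\<close>
  have "l \<noteq> 1"
  proof
    assume "l = 1"
    hence "l = cst 1" by (simp add: cst_def flip: one_pCons)
    with l show False by simp
  qed
  hence l1: "(1 :: 'a ratfun) \<noteq> to_fract l" by (metis to_fract_1 to_fract_eq_iff)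
  have "indep_mod (local_ideal z F G) {1, to_fract l}"
    unfolding indep_mod_def
  proof (intro allI impI ballI)
    fix c s
    assume "(\<Sum>s\<in>{1, to_fract l}. to_fract (cst (c s)) * s) \<in> local_ideal z F G"
      and s: "s \<in> {1, to_fract l}"
    \<comment> \<open>For this combination the derivative along \<open>(v, w)\<close> forces the
      coefficient of \<open>l\<close> to be 0, and then the value at \<open>z\<close> forces the
      constant to be 0.\<close>
    define r where "r = cst (c 1) + cst (c (to_fract l)) * l"
    have "to_fract r \<in> local_ideal z F G"
      using \<open>_ \<in> local_ideal z F G\<close> l1 by (simp add: r_def)
    then obtain u a b where u: "eval2 u z \<noteq> 0" "r * u = a * F + b * G"
      using local_ideal_to_fractD by blast
    have r0: "eval2 r z = 0"
      using arg_cong[OF u(2), of "\<lambda>p. eval2 p z"] F G u(1) by simp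
    have "eval2 (diff_f r) z * eval2 u z = eval2 a z * eval2 (diff_f F) z + eval2 b z * eval2 (diff_f G) z"
      using arg_cong[OF u(2), of "\<lambda>p. eval2 (diff_f p) z"] F G r0 by (simp add: eval2_diff_f_mult)
    moreover have "eval2 (diff_g r) z * eval2 u z = eval2 a z * eval2 (diff_g F) z + eval2 b z * eval2 (diff_g G) z"
      using arg_cong[OF u(2), of "\<lambda>p. eval2 (diff_g p) z"] F G r0 by (simp add: eval2_diff_g_mult)
    ultimately have "(v * eval2 (diff_f r) z + w * eval2 (diff_g r) z) * eval2 u z
        = eval2 a z * (v * eval2 (diff_f F) z + w * eval2 (diff_g F) z)
          + eval2 b z * (v * eval2 (diff_f G) z + w * eval2 (diff_g G) z)"
      by (simp add: algebra_simps)
    hence "v * eval2 (diff_f r) z + w * eval2 (diff_g r) z = 0" using F' G' u(1) by simp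
    moreover have "v * eval2 (diff_f r) z + w * eval2 (diff_g r) z
        = c (to_fract l) * (v * eval2 (diff_f l) z + w * eval2 (diff_g l) z)"
      by (simp add: r_def eval2_diff_f_mult eval2_diff_g_mult algebra_simps)
    ultimately have "c (to_fract l) = 0" using l by simp
    moreover from this have "c 1 = 0" using r0 by (simp add: r_def)
    ultimately show "c s = 0" using s by auto
  qed
  from intersection_mult_ge_card[OF _ _ this] to_fract_in_local_ring[of 1 z] to_fract_in_local_ring[of l z] l1
  show ?thesis by (simp add: numeral_eq_enat numeral_2_eq_2)
qed

text \<open>One of the two coordinate functions is not annihilated by the nonzero vector
  \<open>(v, w)\<close> and serves as \<open>l\<close>.\<close>

lemma intersection_mult_ge_2:
  assumes "eval2 F z = 0" "eval2 G z = 0" "(v, w) \<noteq> (0, 0)"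
    and "v * eval2 (diff_f F) z + w * eval2 (diff_g F) z = 0"
    and "v * eval2 (diff_f G) z + w * eval2 (diff_g G) z = 0"
  shows "intersection_mult F G z \<ge> 2"
proof (cases "v = 0")
  case True
  with assms show ?thesis by (intro intersection_mult_ge_2_aux[where l = var_g and v = v and w = w]) auto
next
  case False
  with assms show ?thesis by (intro intersection_mult_ge_2_aux[where l = var_f and v = v and w = w]) auto
qed

section \<open>Compactness of the curve in a quadrant\<close>

lemma positive_form_lower_bound:
  fixes A B C :: real
  assumes A: "A > 0" and disc: "4 * A * C > B\<^sup>2"
  shows "\<exists>m>0. \<forall>u v. A * u\<^sup>2 + B * u * v + C * v\<^sup>2 \<ge> m * (u\<^sup>2 + v\<^sup>2)"
proof -
  have "4 * A * C > 0" using disc by (rule order_le_less_trans[rotated]) simp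
  hence C: "C > 0" using A by (simp add: zero_less_mult_iff)
  \<comment> \<open>Determinant over trace of the symmetric matrix of the form, a lower bound for
    its smaller eigenvalue.\<close>
  define m where "m = (4 * A * C - B\<^sup>2) / (4 * (A + C))"
  have m: "m > 0" using A C disc by (simp add: m_def)
  have m_eq: "4 * m * (A + C) = 4 * A * C - B\<^sup>2"
  proof -
    have "4 * (A + C) \<noteq> 0" using A C by simp
    hence "m * (4 * (A + C)) = 4 * A * C - B\<^sup>2" unfolding m_def by simp
    thus ?thesis by (simp add: algebra_simps)
  qed
  have "m < A"
  proof (rule ccontr)
    assume "\<not> m < A"
    hence "A * (A + C) \<le> m * (A + C)" using A C by (intro mult_right_mono) auto
    hence "4 * (A * A) + B\<^sup>2 \<le> 0" using m_eq by (simp add: algebra_simps)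
    moreover have "A * A > 0" "B\<^sup>2 \<ge> 0" using A by simp_all
    ultimately show False by linarith
  qed
  have "m * (u\<^sup>2 + v\<^sup>2) \<le> A * u\<^sup>2 + B * u * v + C * v\<^sup>2" for u v
  proof -
    \<comment> \<open>Completes the square for the form minus \<open>m * (u^2 + v^2)\<close>; by the
      choice of \<open>m\<close> the coefficient left over is \<open>4 * m^2\<close>.\<close>
    have "4 * (A - m) * (A * u\<^sup>2 + B * u * v + C * v\<^sup>2 - m * (u\<^sup>2 + v\<^sup>2))
        = (2 * (A - m) * u + B * v)\<^sup>2 + (4 * A * C - B\<^sup>2 - 4 * m * (A + C) + 4 * m\<^sup>2) * v\<^sup>2"
      by (simp add: power2_eq_square algebra_simps)
    also have "\<dots> = (2 * (A - m) * u + B * v)\<^sup>2 + 4 * m\<^sup>2 * v\<^sup>2" by (simp add: m_eq)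
    also have "\<dots> \<ge> 0" by simp
    finally show ?thesis using \<open>m < A\<close> by (simp add: zero_le_mult_iff)
  qed
  with m show ?thesis by blast
qed

text \<open>
  \<open>polygon_weight\<close> is the sum of the monomials at the vertices and at the centre of the Newton polygon of \<open>Q\<close>;
  \<open>inner_monomials\<close> is the sum over its interior lattice points, which stay in the polygon when moved
  by one unit in any of the four directions.
\<close>

definition inner_monomials :: "real \<Rightarrow> real \<Rightarrow> real" where
  "inner_monomials u v = u * v^2 + u^2 * v + u * v^3 + u^3 * v + u^2 * v^2 + u^2 * v^3 + u^3 * v^2"

definition polygon_weight :: "real \<Rightarrow> real \<Rightarrow> real" where
  "polygon_weight u v = (u\<^sup>2 + v\<^sup>2) * (1 + v\<^sup>2) * (1 + u\<^sup>2)"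

lemma inner_monomials_commute: "inner_monomials u v = inner_monomials v u"
  by (simp add: inner_monomials_def algebra_simps)

lemma polygon_weight_commute: "polygon_weight u v = polygon_weight v u"
  by (simp add: polygon_weight_def algebra_simps)

text \<open>Multiplying or dividing by \<open>u\<close> moves each interior monomial to a lattice
  point still in the polygon, where a square bounds it by monomials of the weight. The constant 7
  counts the interior monomials.\<close>

lemma inner_monomials_le:
  assumes "u \<ge> 0"
  shows "inner_monomials u v * u \<le> 7 * polygon_weight u v"
    and "inner_monomials u v \<le> 7 * polygon_weight u v * u"
proof -
  have sq: "0 \<le> u^2" "0 \<le> v^2" "0 \<le> u^4" "0 \<le> v^4" "0 \<le> u^2 * v^2" "0 \<le> u^4 * v^2" "0 \<le> u^2 * v^4" by simp_all
  have w: "polygon_weight u v = u^2 + v^2 + u^4 + 2 * (u^2 * v^2) + v^4 + u^4 * v^2 + u^2 * v^4"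
    unfolding polygon_weight_def by algebra
  have "inner_monomials u v * u = u^2 * v^2 + u^3 * v + u^2 * v^3 + u^4 * v + u^3 * v^2 + u^3 * v^3 + u^4 * v^2"
    unfolding inner_monomials_def by algebra
  note i = this
  have f0: "0 \<le> u^2 * v^2 + u^2 * v^4 - 2 * (u^2 * v^3)"
    using zero_le_power2[of "(u * v * (1-v))"] by (simp add: algebra_simps eval_nat_numeral)
  have f1: "0 \<le> u^4 + u^2 * v^2 - 2 * (u^3 * v)"
    using zero_le_power2[of "(u * (u-v))"] by (simp add: algebra_simps eval_nat_numeral)
  have f2: "0 \<le> u^2 * v^2 + u^4 * v^2 - 2 * (u^3 * v^2)"
    using zero_le_power2[of "(u * v * (1-u))"] by (simp add: algebra_simps eval_nat_numeral)
  have f3: "0 \<le> u^4 * v^2 + u^2 * v^4 - 2 * (u^3 * v^3)"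
    using zero_le_power2[of "(u * v * (u-v))"] by (simp add: algebra_simps eval_nat_numeral)
  have f4: "0 \<le> u^4 + u^4 * v^2 - 2 * (u^4 * v)"
    using zero_le_power2[of "(u * u * (1-v))"] by (simp add: algebra_simps eval_nat_numeral)
  show "inner_monomials u v * u \<le> 7 * polygon_weight u v"
    using sq f0 f1 f2 f3 f4 unfolding w i distrib_left by (smt (verit))
  \<comment> \<open>\<open>inner_monomials u v\<close> divided by \<open>u\<close>, written out as a
    polynomial.\<close>
  define t where "t = v^2 + u * v + v^3 + u^2 * v + u * v^2 + u * v^3 + u^2 * v^2"
  have g0: "0 \<le> v^2 + v^4 - 2 * v^3"
    using zero_le_power2[of "(v * (1-v))"] by (simp add: algebra_simps eval_nat_numeral)
  have g1: "0 \<le> u^2 + v^2 - 2 * (u * v)"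
    using zero_le_power2[of "(u-v)"] by (simp add: algebra_simps eval_nat_numeral)
  have g2: "0 \<le> v^2 + u^2 * v^2 - 2 * (u * v^2)"
    using zero_le_power2[of "(v * (1-u))"] by (simp add: algebra_simps eval_nat_numeral)
  have g3: "0 \<le> v^4 + u^2 * v^2 - 2 * (u * v^3)"
    using zero_le_power2[of "(v * (v-u))"] by (simp add: algebra_simps eval_nat_numeral)
  have g4: "0 \<le> u^2 + u^2 * v^2 - 2 * (u^2 * v)"
    using zero_le_power2[of "(u * (1-v))"] by (simp add: algebra_simps eval_nat_numeral)
  have "t \<le> 7 * polygon_weight u v" using sq g0 g1 g2 g3 g4 unfolding w t_def distrib_left by (smt (verit))
  from mult_right_mono[OF this assms] show "inner_monomials u v \<le> 7 * polygon_weight u v * u"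
    unfolding inner_monomials_def t_def by (simp add: algebra_simps eval_nat_numeral)
qed

text \<open>
  \<open>k x X'(x) - X(x)\<close> is quadratic in \<open>x\<close> with zero \<open>x0\<close> and a second zero of the opposite sign, so it has the factor
  \<open>x - x0\<close> and a cofactor of constant sign on the half-line of \<open>x0\<close>.
\<close>

locale quadratic =
  fixes c2 c1 c0 k x0 :: real
  assumes c2: "c2 > 0" and disc: "4 * c2 * c0 > c1\<^sup>2" and k: "k > 1" and x0: "x0 \<noteq> 0"
    and zero: "k * x0 * (2 * c2 * x0 + c1) = c2 * x0\<^sup>2 + c1 * x0 + c0"
begin

definition X :: "real \<Rightarrow> real" where "X x = c2 * x\<^sup>2 + c1 * x + c0"

definition X' :: "real \<Rightarrow> real" where "X' x = 2 * c2 * x + c1"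

text \<open>The roots of \<open>k * x * X' x - X x\<close> have product
  \<open>- c0 / ((2 * k - 1) * c2)\<close>, which gives the second root from \<open>x0\<close>.
  \<open>w\<close> is the resulting cofactor of \<open>x - x0\<close>, divided by
  \<open>k * x * X x\<close>.\<close>

definition w :: "real \<Rightarrow> real" where
  "w x = ((2 * k - 1) * c2 * x * x0 + c0) / (k * x * x0 * X x)"

lemma c0: "c0 > 0"
proof -
  have "4 * c2 * c0 > 0" using disc by (rule order_le_less_trans[rotated]) simp
  thus ?thesis using c2 by (simp add: zero_less_mult_iff)
qed

lemma X_pos: "X x > 0"
proof -
  have "4 * c2 * X x = (2 * c2 * x + c1)\<^sup>2 + (4 * c2 * c0 - c1\<^sup>2)"
    by (simp add: X_def power2_eq_square algebra_simps)
  also have "\<dots> > 0" using disc by (intro add_nonneg_pos) simp_all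
  finally show ?thesis using c2 by (simp add: zero_less_mult_iff)
qed

lemma X_deriv: "(X has_real_derivative X' x) (at x)"
  unfolding X_def[abs_def] X'_def by (auto intro!: derivative_eq_intros)

lemma w_pos: assumes "x * x0 > 0" shows "w x > 0"
proof -
  have "(2 * k - 1) * c2 * (x * x0) + c0 > 0"
    using k c2 by (intro add_pos_pos[OF mult_pos_pos[OF _ assms] c0]) simp
  moreover have "k * (x * x0) * X x > 0" using k by (intro mult_pos_pos[OF mult_pos_pos[OF _ assms] X_pos]) simp
  ultimately show ?thesis by (simp add: w_def mult.assoc)
qed

lemma w_cont: "x \<noteq> 0 \<Longrightarrow> isCont w x"
  unfolding w_def[abs_def] X_def[abs_def]
  using x0 k X_pos[of x] by (intro continuous_intros) (auto simp: X_def)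

lemma numerator_eq:
  assumes "x \<noteq> 0"
  shows "k * x * X' x - X x = (x - x0) * w x * (k * x * X x)"
proof -
  have "(x - x0) * w x * (k * x * X x) * x0 = (x - x0) * ((2 * k - 1) * c2 * x * x0 + c0)"
    using assms k x0 X_pos[of x] by (simp add: w_def)
  also have "\<dots> = (k * x * X' x - X x) * x0"
    using zero unfolding X'_def X_def by algebra
  finally show ?thesis using x0 by simp
qed

text \<open>A primitive of \<open>X' / X - 1 / (k * x)\<close>. Half of \<open>ln (x^2)\<close> is
  the logarithm of the absolute value of \<open>x\<close>, so the same formula serves both
  half-lines.\<close>

definition A :: "real \<Rightarrow> real" where "A x = ln (X x) - ln (x\<^sup>2) / (2 * k)"

lemma A_deriv: assumes "x \<noteq> 0" shows "(A has_real_derivative (x - x0) * w x) (at x)"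
proof -
  have "(A has_real_derivative X' x / X x - 1 / (k * x)) (at x)"
    unfolding A_def[abs_def] using X_pos[of x] assms k
    by (auto intro!: derivative_eq_intros X_deriv simp: zero_less_power2) (simp add: power2_eq_square)
  moreover have "X' x / X x - 1 / (k * x) = (k * x * X' x - X x) / (k * x * X x)"
    using assms k X_pos[of x] by (simp add: field_simps)
  moreover have "\<dots> = (x - x0) * w x" using assms k X_pos[of x] by (simp add: numerator_eq)
  ultimately show ?thesis by simp
qed

end

text \<open>Caratheodory's form of differentiability: the value of a continuous cofactor is the
  derivative.\<close>

lemma DERIV_mult_vanishing:
  fixes h :: "real \<Rightarrow> real"
  assumes "isCont h x0"
  shows "((\<lambda>x. (x - x0) * h x) has_real_derivative h x0) (at x0)"
  unfolding CARAT_DERIV by (rule exI[of _ h]) (use assms in \<open>simp add: mult.commute\<close>)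

section \<open>The forms \<open>xi1\<close>, \<open>xi2\<close>, \<open>xi3\<close> and the
  polynomials \<open>Q\<close>, \<open>R\<close> in coordinates\<close>

lemma eval2_xi_expand:
  "eval2 (xi1 a b \<zeta>2) (x, y) = \<zeta>2\<^sup>2 * x\<^sup>2 + (2 * a * \<zeta>2) * x * y + (a\<^sup>2 + b\<^sup>2) * y\<^sup>2"
  "eval2 (xi2 a b \<zeta>1) (x, y) = ((a - 1)\<^sup>2 + b\<^sup>2) * y\<^sup>2 + (- 2 * (a - 1) * \<zeta>1) * y + \<zeta>1\<^sup>2"
  "eval2 (xi3 a b \<zeta>1 \<zeta>2) (x, y) = (\<zeta>2\<^sup>2 * ((a - 1)\<^sup>2 + b\<^sup>2)) * x\<^sup>2 + (2 * \<zeta>1 * \<zeta>2 * (a * (a - 1) + b\<^sup>2)) * x + (\<zeta>1\<^sup>2 * (a\<^sup>2 + b\<^sup>2))"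
  by (simp_all add: eval2_xi1 eval2_xi2 eval2_xi3 power2_eq_square algebra_simps)

lemma eval2_diff_xi:
  "eval2 (diff_f (xi1 a b \<zeta>2)) (x, y) = 2 * \<zeta>2\<^sup>2 * x + (2 * a * \<zeta>2) * y"
  "eval2 (diff_g (xi1 a b \<zeta>2)) (x, y) = (2 * a * \<zeta>2) * x + 2 * (a\<^sup>2 + b\<^sup>2) * y"
  "eval2 (diff_g (xi2 a b \<zeta>1)) (x, y) = 2 * ((a - 1)\<^sup>2 + b\<^sup>2) * y + (- 2 * (a - 1) * \<zeta>1)"
  "eval2 (diff_f (xi3 a b \<zeta>1 \<zeta>2)) (x, y) = 2 * (\<zeta>2\<^sup>2 * ((a - 1)\<^sup>2 + b\<^sup>2)) * x + (2 * \<zeta>1 * \<zeta>2 * (a * (a - 1) + b\<^sup>2))"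
  by (simp_all add: xi1_def xi2_def xi3_def eval2_diff_power2 eval2_diff_f_mult eval2_diff_g_mult)
    (simp_all add: power2_eq_square algebra_simps)

text \<open>Each difference is \<open>4 * b^2\<close> times a positive square; for the third this is
  Lagrange's identity for the vectors \<open>(a, b)\<close> and \<open>(a - 1, b)\<close>.\<close>

lemma discriminants:
  fixes a b \<zeta>1 \<zeta>2 :: real
  assumes b: "b \<noteq> 0" and z1: "\<zeta>1 > 0" and z2: "\<zeta>2 > 0"
  shows
  "4 * \<zeta>2\<^sup>2 * (a\<^sup>2 + b\<^sup>2) > (2 * a * \<zeta>2)\<^sup>2" "4 * ((a - 1)\<^sup>2 + b\<^sup>2) * \<zeta>1\<^sup>2 > (- 2 * (a - 1) * \<zeta>1)\<^sup>2" "4 * (\<zeta>2\<^sup>2 * ((a - 1)\<^sup>2 + b\<^sup>2)) * (\<zeta>1\<^sup>2 * (a\<^sup>2 + b\<^sup>2)) > (2 * \<zeta>1 * \<zeta>2 * (a * (a - 1) + b\<^sup>2))\<^sup>2"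
  "\<zeta>2\<^sup>2 > 0" "((a - 1)\<^sup>2 + b\<^sup>2) > 0" "(\<zeta>2\<^sup>2 * ((a - 1)\<^sup>2 + b\<^sup>2)) > 0"
proof -
  have p: "b\<^sup>2 > 0" "\<zeta>1\<^sup>2 > 0" "\<zeta>2\<^sup>2 > 0" using b z1 z2 by simp_all
  show "\<zeta>2\<^sup>2 > 0" "((a - 1)\<^sup>2 + b\<^sup>2) > 0" "(\<zeta>2\<^sup>2 * ((a - 1)\<^sup>2 + b\<^sup>2)) > 0" using p by (simp_all add: add_nonneg_pos)
  have "4 * \<zeta>2\<^sup>2 * (a\<^sup>2 + b\<^sup>2) - (2 * a * \<zeta>2)\<^sup>2 = 4 * (\<zeta>2\<^sup>2 * b\<^sup>2)" "4 * ((a - 1)\<^sup>2 + b\<^sup>2) * \<zeta>1\<^sup>2 - (- 2 * (a - 1) * \<zeta>1)\<^sup>2 = 4 * (\<zeta>1\<^sup>2 * b\<^sup>2)"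
    "4 * (\<zeta>2\<^sup>2 * ((a - 1)\<^sup>2 + b\<^sup>2)) * (\<zeta>1\<^sup>2 * (a\<^sup>2 + b\<^sup>2)) - (2 * \<zeta>1 * \<zeta>2 * (a * (a - 1) + b\<^sup>2))\<^sup>2 = 4 * (\<zeta>1\<^sup>2 * \<zeta>2\<^sup>2 * b\<^sup>2)"
    by (simp_all add: power2_eq_square algebra_simps)
  moreover have "\<zeta>2\<^sup>2 * b\<^sup>2 > 0" "\<zeta>1\<^sup>2 * b\<^sup>2 > 0" "\<zeta>1\<^sup>2 * \<zeta>2\<^sup>2 * b\<^sup>2 > 0" using p by simp_all
  ultimately show "4 * \<zeta>2\<^sup>2 * (a\<^sup>2 + b\<^sup>2) > (2 * a * \<zeta>2)\<^sup>2" "4 * ((a - 1)\<^sup>2 + b\<^sup>2) * \<zeta>1\<^sup>2 > (- 2 * (a - 1) * \<zeta>1)\<^sup>2" "4 * (\<zeta>2\<^sup>2 * ((a - 1)\<^sup>2 + b\<^sup>2)) * (\<zeta>1\<^sup>2 * (a\<^sup>2 + b\<^sup>2)) > (2 * \<zeta>1 * \<zeta>2 * (a * (a - 1) + b\<^sup>2))\<^sup>2" by linarith+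
qed

lemma eval2_Q:
  fixes a b \<zeta>1 \<zeta>2 \<alpha> x y :: real
  assumes b: "b \<noteq> 0" and z1: "\<zeta>1 > 0" and z2: "\<zeta>2 > 0" and al: "\<alpha> > 0"
  defines "k \<equiv> \<alpha> + 1"
  shows "k\<^sup>2 * eval2 (Q_poly a b \<zeta>1 \<zeta>2 \<alpha>) (x, y) =
     eval2 (xi3 a b \<zeta>1 \<zeta>2) (x, y)
       * (eval2 (xi1 a b \<zeta>2) (x, y) - k * x * eval2 (diff_f (xi1 a b \<zeta>2)) (x, y))
       * (eval2 (xi2 a b \<zeta>1) (x, y) - k * y * eval2 (diff_g (xi2 a b \<zeta>1)) (x, y))
     - k * y * (eval2 (diff_g (xi2 a b \<zeta>1)) (x, y) * eval2 (xi1 a b \<zeta>2) (x, y)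
         - eval2 (xi2 a b \<zeta>1) (x, y) * eval2 (diff_g (xi1 a b \<zeta>2)) (x, y))
       * (k * x * eval2 (diff_f (xi3 a b \<zeta>1 \<zeta>2)) (x, y) - eval2 (xi3 a b \<zeta>1 \<zeta>2) (x, y))"
proof -
  have k: "k * (1 / k) = 1" using al by (simp add: k_def)
  have *: "k\<^sup>2 * (1 / k * (1 / k) * p - 1 / k * y * r) = (k * (1 / k)) * (k * (1 / k)) * p - k * (k * (1 / k)) * y * r" for p r
    by (simp add: power2_eq_square algebra_simps)
  show ?thesis
    unfolding Q_poly_eq[OF b z1 z2 al] eval2_simps fst_conv snd_conv k_def[symmetric]
    unfolding mult.assoc[of "1 / k * (1 / k)"] mult.assoc[of "1 / k * y"] * k
    by (simp add: mult.assoc)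
qed

lemma eval2_R:
  fixes a b \<zeta>1 \<zeta>2 \<alpha> x y :: real
  assumes b: "b \<noteq> 0" and z1: "\<zeta>1 > 0" and z2: "\<zeta>2 > 0" and al: "\<alpha> > 0"
  defines "k \<equiv> \<alpha> + 1"
  shows "k * eval2 (R_poly a b \<zeta>1 \<zeta>2 \<alpha>) (x, y) =
     x * eval2 (xi3 a b \<zeta>1 \<zeta>2) (x, y) * eval2 (diff_f (Q_poly a b \<zeta>1 \<zeta>2 \<alpha>)) (x, y)
       * (eval2 (xi2 a b \<zeta>1) (x, y) - k * y * eval2 (diff_g (xi2 a b \<zeta>1)) (x, y))
     - y * eval2 (xi2 a b \<zeta>1) (x, y) * eval2 (diff_g (Q_poly a b \<zeta>1 \<zeta>2 \<alpha>)) (x, y)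
       * (k * x * eval2 (diff_f (xi3 a b \<zeta>1 \<zeta>2)) (x, y) - eval2 (xi3 a b \<zeta>1 \<zeta>2) (x, y))"
proof -
  have k: "k * (1 / k) = 1" using al by (simp add: k_def)
  have *: "k * (1 / k * p - 1 / k * r) = (k * (1 / k)) * p - (k * (1 / k)) * r" for p r
    by (simp add: algebra_simps)
  show ?thesis
    unfolding R_poly_eq[OF b z1 z2 al] eval2_simps fst_conv snd_conv k_def[symmetric]
    unfolding mult.assoc[of "1 / k"] * k by (simp add: mult.assoc)
qed

section \<open>Bounds on the curve inside a quadrant\<close>

lemma half_line_compact:
  fixes I :: "real set"
  assumes "I \<in> {{0<..}, {..<0}}" "M > 0"
  shows "\<exists>I'. compact I' \<and> I' \<subseteq> I \<and> (\<forall>x\<in>I. \<bar>x\<bar> \<le> M \<longrightarrow> 1 \<le> M * \<bar>x\<bar> \<longrightarrow> x \<in> I')"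
proof (cases "I = {0<..}")
  case True
  have M: "1 / M > 0" using assms by simp
  have "{1/M..M} \<subseteq> I"
  proof
    fix x assume "x \<in> {1/M..M}"
    with M have "0 < x" unfolding atLeastAtMost_iff by linarith
    thus "x \<in> I" by (simp add: True)
  qed
  moreover have "x \<in> {1/M..M}" if "x \<in> I" "\<bar>x\<bar> \<le> M" "1 \<le> M * \<bar>x\<bar>" for x
    using that assms(2) True by (simp add: field_simps)
  ultimately show ?thesis by (intro exI[of _ "{1/M..M}"]) auto
next
  case False
  hence I: "I = {..<0}" using assms by auto
  have M: "1 / M > 0" using assms by simp
  have "{-M..-(1/M)} \<subseteq> I"
  proof
    fix x assume "x \<in> {-M..-(1/M)}"
    with M have "x < 0" unfolding atLeastAtMost_iff by linarith
    thus "x \<in> I" by (simp add: I)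
  qed
  moreover have "x \<in> {-M..-(1/M)}" if "x \<in> I" "\<bar>x\<bar> \<le> M" "1 \<le> M * \<bar>x\<bar>" for x
    using that assms(2) I by (simp add: field_simps)
  ultimately show ?thesis by (intro exI[of _ "{-M..-(1/M)}"]) auto
qed

text \<open>The terms containing \<open>k * y * G\<close> cancel, and Euler's relation for the
  homogeneous quadratic \<open>X1\<close> merges the other terms linear in \<open>k\<close> into
  \<open>- 2 * k * (X1 * X2 * X3)\<close>. This splits a product of positive forms from a
  remainder.\<close>

lemma Euler_reduction:
  fixes x y k X1 X2 X3 F E G P :: real
  assumes "x * F + y * E = 2 * X1"
  shows "X3 * (X1 - k * x * F) * (X2 - k * y * G) - k * y * (G * X1 - X2 * E) * (k * x * P - X3)
    = (1 - 2 * k) * (X1 * X2 * X3)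
      + k\<^sup>2 * (x * F * (y * G) * X3 + x * P * (y * E) * X2 - x * P * (y * G) * X1)"
  using assms by algebra

text \<open>The boundary monomials of the Newton polygon cancel, for instance \<open>x^4 * y\<close>
  between the first and the third product. Only the seven interior ones survive.\<close>

lemma interior_expansion:
  fixes x y e2 e1 e0 d2 d1 d0 c2 c1 c0 :: real
  shows "x * (2 * e2 * x + e1 * y) * (y * (2 * d2 * y + d1)) * (c2 * x\<^sup>2 + c1 * x + c0)
      + x * (2 * c2 * x + c1) * (y * (e1 * x + 2 * e0 * y)) * (d2 * y\<^sup>2 + d1 * y + d0)
      - x * (2 * c2 * x + c1) * (y * (2 * d2 * y + d1)) * (e2 * x\<^sup>2 + e1 * x * y + e0 * y\<^sup>2)
    = (c0 * d1 * e1 + 2 * c1 * d0 * e0) * (x * y^2) + (2 * c0 * d1 * e2 + c1 * d0 * e1) * (x^2 * y)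
      + (2 * c0 * d2 * e1 + c1 * d1 * e0) * (x * y^3) + (c1 * d1 * e2 + 2 * c2 * d0 * e1) * (x^3 * y)
      + (4 * c0 * d2 * e2 + c1 * d1 * e1 + 4 * c2 * d0 * e0) * (x^2 * y^2)
      + (c1 * d2 * e1 + 2 * c2 * d1 * e0) * (x^2 * y^3)
      + (2 * c1 * d2 * e2 + c2 * d1 * e1) * (x^3 * y^2)"
  by (simp add: algebra_simps power2_eq_square power3_eq_cube)

lemma abs_interior_le:
  fixes x y C n1 n2 n3 n4 n5 n6 n7 :: real
  assumes n: "\<bar>n1\<bar> \<le> C" "\<bar>n2\<bar> \<le> C" "\<bar>n3\<bar> \<le> C" "\<bar>n4\<bar> \<le> C" "\<bar>n5\<bar> \<le> C" "\<bar>n6\<bar> \<le> C" "\<bar>n7\<bar> \<le> C"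
  shows "\<bar>n1 * (x * y^2) + n2 * (x^2 * y) + n3 * (x * y^3) + n4 * (x^3 * y) + n5 * (x^2 * y^2)
      + n6 * (x^2 * y^3) + n7 * (x^3 * y^2)\<bar>
    \<le> C * inner_monomials \<bar>x\<bar> \<bar>y\<bar>"
proof -
  have *: "\<bar>n * (x ^ i * y ^ j)\<bar> \<le> C * (\<bar>x\<bar> ^ i * \<bar>y\<bar> ^ j)" if "\<bar>n\<bar> \<le> C" for n i j
    unfolding abs_mult power_abs by (intro mult_right_mono that) simp
  show ?thesis
    using *[OF n(1), of 1 2] *[OF n(2), of 2 1] *[OF n(3), of 1 3] *[OF n(4), of 3 1]
      *[OF n(5), of 2 2] *[OF n(6), of 2 3] *[OF n(7), of 3 2]
    unfolding power_one_right inner_monomials_def distrib_left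
    by - (intro order_trans[OF abs_triangle_ineq add_mono]; assumption)
qed

lemma interior_bounded:
  fixes n1 n2 n3 n4 n5 n6 n7 :: real
  shows "\<exists>C\<ge>0. \<forall>x y. \<bar>n1 * (x * y^2) + n2 * (x^2 * y) + n3 * (x * y^3) + n4 * (x^3 * y) + n5 * (x^2 * y^2)
      + n6 * (x^2 * y^3) + n7 * (x^3 * y^2)\<bar>
    \<le> C * inner_monomials \<bar>x\<bar> \<bar>y\<bar>"
proof (intro exI conjI allI abs_interior_le)
  let ?C = "Max {\<bar>n1\<bar>, \<bar>n2\<bar>, \<bar>n3\<bar>, \<bar>n4\<bar>, \<bar>n5\<bar>, \<bar>n6\<bar>, \<bar>n7\<bar>}"
  show n: "\<bar>n1\<bar> \<le> ?C" "\<bar>n2\<bar> \<le> ?C" "\<bar>n3\<bar> \<le> ?C" "\<bar>n4\<bar> \<le> ?C" "\<bar>n5\<bar> \<le> ?C" "\<bar>n6\<bar> \<le> ?C" "\<bar>n7\<bar> \<le> ?C"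
    by (intro Max_ge; simp)+
  show "0 \<le> ?C" using abs_ge_zero n(1) by (rule order_trans)
qed

text \<open>On the curve \<open>(2 * k - 1) * (X1 * X2 * X3) = k^2 * N\<close>. The left side is at
  least a positive multiple of \<open>polygon_weight\<close>, the right side at most a multiple of
  \<open>inner_monomials\<close>, and close to an axis or far out the interior monomials are too
  small for this.\<close>

lemma Gamma_bounded:
  fixes a b \<zeta>1 \<zeta>2 \<alpha> :: real
  assumes b: "b \<noteq> 0" and z1: "\<zeta>1 > 0" and z2: "\<zeta>2 > 0" and al: "\<alpha> > 0"
  shows "\<exists>M>0. \<forall>x y. x \<noteq> 0 \<longrightarrow> y \<noteq> 0 \<longrightarrow> eval2 (Q_poly a b \<zeta>1 \<zeta>2 \<alpha>) (x, y) = 0 \<longrightarrow>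
    \<bar>x\<bar> \<le> M \<and> 1 \<le> M * \<bar>x\<bar> \<and> \<bar>y\<bar> \<le> M \<and> 1 \<le> M * \<bar>y\<bar>"
proof -
  define e2 e1 e0 where "e2 = \<zeta>2\<^sup>2" and "e1 = 2 * a * \<zeta>2" and "e0 = a\<^sup>2 + b\<^sup>2"
  define d2 d1 d0 where "d2 = (a - 1)\<^sup>2 + b\<^sup>2" and "d1 = - 2 * (a - 1) * \<zeta>1" and "d0 = \<zeta>1\<^sup>2"
  define c2 c1 c0 where "c2 = \<zeta>2\<^sup>2 * ((a - 1)\<^sup>2 + b\<^sup>2)" and "c1 = 2 * \<zeta>1 * \<zeta>2 * (a * (a - 1) + b\<^sup>2)"
    and "c0 = \<zeta>1\<^sup>2 * (a\<^sup>2 + b\<^sup>2)"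
  note defs = e2_def e1_def e0_def d2_def d1_def d0_def c2_def c1_def c0_def
  define k where "k = \<alpha> + 1"
  have k: "k > 1" using al by (simp add: k_def)
  have disc: "4 * e2 * e0 > e1\<^sup>2" "4 * d2 * d0 > d1\<^sup>2" "4 * c2 * c0 > c1\<^sup>2"
    "e2 > 0" "d2 > 0" "c2 > 0"
    unfolding defs by (rule discriminants[OF b z1 z2])+
  have xi: "eval2 (xi1 a b \<zeta>2) (x, y) = e2 * x\<^sup>2 + e1 * x * y + e0 * y\<^sup>2"
    "eval2 (xi2 a b \<zeta>1) (x, y) = d2 * y\<^sup>2 + d1 * y + d0"
    "eval2 (xi3 a b \<zeta>1 \<zeta>2) (x, y) = c2 * x\<^sup>2 + c1 * x + c0" for x y
    unfolding defs by (rule eval2_xi_expand)+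
  have dxi: "eval2 (diff_f (xi1 a b \<zeta>2)) (x, y) = 2 * e2 * x + e1 * y"
    "eval2 (diff_g (xi1 a b \<zeta>2)) (x, y) = e1 * x + 2 * e0 * y"
    "eval2 (diff_g (xi2 a b \<zeta>1)) (x, y) = 2 * d2 * y + d1"
    "eval2 (diff_f (xi3 a b \<zeta>1 \<zeta>2)) (x, y) = 2 * c2 * x + c1" for x y
    unfolding defs by (rule eval2_diff_xi)+
  obtain m1 where m1: "m1 > 0" "\<And>u v. m1 * (u\<^sup>2 + v\<^sup>2) \<le> e2 * u\<^sup>2 + e1 * u * v + e0 * v\<^sup>2"
    using positive_form_lower_bound[OF disc(4,1)] by blast
  obtain m2 where m2: "m2 > 0" "\<And>u v. m2 * (u\<^sup>2 + v\<^sup>2) \<le> d2 * u\<^sup>2 + d1 * u * v + d0 * v\<^sup>2"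
    using positive_form_lower_bound[OF disc(5,2)] by blast
  obtain m3 where m3: "m3 > 0" "\<And>u v. m3 * (u\<^sup>2 + v\<^sup>2) \<le> c2 * u\<^sup>2 + c1 * u * v + c0 * v\<^sup>2"
    using positive_form_lower_bound[OF disc(6,3)] by blast
  obtain C where C: "C \<ge> 0" "\<And>x y. \<bar>x * (2 * e2 * x + e1 * y) * (y * (2 * d2 * y + d1)) * (c2 * x\<^sup>2 + c1 * x + c0)
      + x * (2 * c2 * x + c1) * (y * (e1 * x + 2 * e0 * y)) * (d2 * y\<^sup>2 + d1 * y + d0)
      - x * (2 * c2 * x + c1) * (y * (2 * d2 * y + d1)) * (e2 * x\<^sup>2 + e1 * x * y + e0 * y\<^sup>2)\<bar>
      \<le> C * inner_monomials \<bar>x\<bar> \<bar>y\<bar>"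
    unfolding interior_expansion using interior_bounded by blast
  define m where "m = m1 * m2 * m3"
  have m: "m > 0" using m1 m2 m3 by (simp add: m_def)
  \<comment> \<open>Seven times the ratio of the two constants, plus 1 to keep \<open>M\<close>
    positive when \<open>C = 0\<close>.\<close>
  define M where "M = 7 * (k\<^sup>2 * C / ((2 * k - 1) * m)) + 1"
  have M: "M > 0" using k C m by (simp add: M_def add_nonneg_pos)
  have "\<bar>x\<bar> \<le> M \<and> 1 \<le> M * \<bar>x\<bar> \<and> \<bar>y\<bar> \<le> M \<and> 1 \<le> M * \<bar>y\<bar>"
    if xy: "x \<noteq> 0" "y \<noteq> 0" "eval2 (Q_poly a b \<zeta>1 \<zeta>2 \<alpha>) (x, y) = 0" for x y
  proof -
    define X1 X2 X3 where "X1 = e2 * x\<^sup>2 + e1 * x * y + e0 * y\<^sup>2" and "X2 = d2 * y\<^sup>2 + d1 * y + d0"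
      and "X3 = c2 * x\<^sup>2 + c1 * x + c0"
    define N where "N = x * (2 * e2 * x + e1 * y) * (y * (2 * d2 * y + d1)) * X3
      + x * (2 * c2 * x + c1) * (y * (e1 * x + 2 * e0 * y)) * X2
      - x * (2 * c2 * x + c1) * (y * (2 * d2 * y + d1)) * X1"
    let ?n0 = "polygon_weight \<bar>x\<bar> \<bar>y\<bar>" and ?S = "inner_monomials \<bar>x\<bar> \<bar>y\<bar>"
    have "0 = (1 - 2 * k) * (X1 * X2 * X3) + k\<^sup>2 * N"
      using eval2_Q[OF b z1 z2 al, of a x y, unfolded xi dxi xy(3), folded k_def X1_def X2_def X3_def]
      unfolding N_def by (subst (asm) Euler_reduction) (simp_all add: X1_def power2_eq_square algebra_simps)
    hence "(2 * k - 1) * (X1 * X2 * X3) = k\<^sup>2 * N" by (simp add: algebra_simps)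
    also have "\<dots> \<le> k\<^sup>2 * (C * ?S)"
      using C(2)[of x y, folded X1_def X2_def X3_def, folded N_def] by (intro mult_left_mono) auto
    finally have up: "(2 * k - 1) * (X1 * X2 * X3) \<le> k\<^sup>2 * C * ?S" by (simp add: mult.assoc)
    \<comment> \<open>Setting the second variable to 1 turns the bounds for homogeneous forms into
      bounds for \<open>X2\<close> and \<open>X3\<close>.\<close>
    have X: "m1 * (x\<^sup>2 + y\<^sup>2) \<le> X1" "m2 * (y\<^sup>2 + 1) \<le> X2" "m3 * (x\<^sup>2 + 1) \<le> X3"
      using m1(2)[of x y] m2(2)[of y 1] m3(2)[of x 1] by (simp_all add: X1_def X2_def X3_def)
    have nonneg: "0 \<le> m1 * (x\<^sup>2 + y\<^sup>2)" "0 \<le> m2 * (y\<^sup>2 + 1)" "0 \<le> m3 * (x\<^sup>2 + 1)"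
      using m1(1) m2(1) m3(1) by simp_all
    have "m1 * (x\<^sup>2 + y\<^sup>2) * (m2 * (y\<^sup>2 + 1)) * (m3 * (x\<^sup>2 + 1)) \<le> X1 * X2 * X3"
      using X nonneg by (intro mult_mono[OF mult_mono]) (auto intro: order_trans)
    hence low: "m * ?n0 \<le> X1 * X2 * X3" by (simp add: m_def polygon_weight_def algebra_simps)
    have km: "(2 * k - 1) * m > 0" using k m by simp
    have "(2 * k - 1) * m * ?n0 \<le> k\<^sup>2 * C * ?S"
    proof -
      have "(2 * k - 1) * (m * ?n0) \<le> (2 * k - 1) * (X1 * X2 * X3)"
        by (rule mult_left_mono[OF low]) (use k in simp)
      also note up
      finally show ?thesis by (simp only: mult.assoc)
    qed
    hence n0_le: "?n0 \<le> k\<^sup>2 * C / ((2 * k - 1) * m) * ?S" using km by (simp add: field_simps)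
    have n0_pos: "?n0 > 0"
      unfolding polygon_weight_def using xy by (intro mult_pos_pos add_pos_nonneg) simp_all
    define c where "c = k\<^sup>2 * C / ((2 * k - 1) * m)"
    have c: "c \<ge> 0" "?n0 \<le> c * ?S" using n0_le k C m by (simp_all add: c_def)
    \<comment> \<open>Used with \<open>t\<close> the absolute value of either coordinate. Moving the
      interior monomials by \<open>t\<close> in both directions and cancelling the positive weight
      bounds \<open>t\<close> and its inverse.\<close>
    have main: "t \<le> M \<and> 1 \<le> M * t" if t: "t > 0" "?S * t \<le> 7 * ?n0" "?S \<le> 7 * ?n0 * t" for t
    proof
      have "?n0 * t \<le> c * ?S * t" using c t by (intro mult_right_mono) auto
      also have "\<dots> \<le> c * (7 * ?n0)" using mult_left_mono[OF t(2) c(1)] by (simp add: mult.assoc)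
      finally have "?n0 * t \<le> ?n0 * (7 * c)" by (simp add: algebra_simps)
      hence "t \<le> 7 * c" using n0_pos by simp
      thus "t \<le> M" by (simp add: M_def c_def)
      have "?n0 \<le> c * (7 * ?n0 * t)" using c(2) mult_left_mono[OF t(3) c(1)] by linarith
      hence "?n0 * 1 \<le> ?n0 * (7 * c * t)" by (simp add: algebra_simps)
      hence "1 \<le> 7 * c * t" using n0_pos by (simp only: mult_le_cancel_left_pos)
      also have "\<dots> \<le> M * t" using t(1) by (intro mult_right_mono) (simp_all add: M_def c_def)
      finally show "1 \<le> M * t" .
    qed
    have "\<bar>x\<bar> \<le> M \<and> 1 \<le> M * \<bar>x\<bar>"
      using inner_monomials_le[of "\<bar>x\<bar>" "\<bar>y\<bar>"] xy by (intro main) auto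
    moreover have "\<bar>y\<bar> \<le> M \<and> 1 \<le> M * \<bar>y\<bar>"
      using inner_monomials_le[of "\<bar>y\<bar>" "\<bar>x\<bar>"] xy
      by (intro main) (auto simp: inner_monomials_commute[of "\<bar>y\<bar>"] polygon_weight_commute[of "\<bar>y\<bar>"])
    ultimately show ?thesis by blast
  qed
  with M show ?thesis by blast
qed

text \<open>The bounds confine the zeros to a compact rectangle inside the open quadrant.\<close>

lemma Gamma_compact:
  fixes a b \<zeta>1 \<zeta>2 \<alpha> :: real
  assumes "b \<noteq> 0" "\<zeta>1 > 0" "\<zeta>2 > 0" "\<alpha> > 0"
    and I: "I \<in> {{0<..}, {..<0}}" and J: "J \<in> {{0<..}, {..<0}}"
  shows "compact {z\<in>I \<times> J. eval2 (Q_poly a b \<zeta>1 \<zeta>2 \<alpha>) z = 0}"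
proof -
  obtain M where M: "M > 0" "\<And>x y. x \<noteq> 0 \<Longrightarrow> y \<noteq> 0 \<Longrightarrow> eval2 (Q_poly a b \<zeta>1 \<zeta>2 \<alpha>) (x, y) = 0 \<Longrightarrow>
    \<bar>x\<bar> \<le> M \<and> 1 \<le> M * \<bar>x\<bar> \<and> \<bar>y\<bar> \<le> M \<and> 1 \<le> M * \<bar>y\<bar>"
    using Gamma_bounded[OF assms(1-4), of a] by metis
  obtain I' where I': "compact I'" "I' \<subseteq> I" "\<And>x. x \<in> I \<Longrightarrow> \<bar>x\<bar> \<le> M \<Longrightarrow> 1 \<le> M * \<bar>x\<bar> \<Longrightarrow> x \<in> I'"
    using half_line_compact[OF I M(1)] by blast
  obtain J' where J': "compact J'" "J' \<subseteq> J" "\<And>x. x \<in> J \<Longrightarrow> \<bar>x\<bar> \<le> M \<Longrightarrow> 1 \<le> M * \<bar>x\<bar> \<Longrightarrow> x \<in> J'"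
    using half_line_compact[OF J M(1)] by blast
  have nz: "0 \<notin> I" "0 \<notin> J" using I J by auto
  have "{z\<in>I \<times> J. eval2 (Q_poly a b \<zeta>1 \<zeta>2 \<alpha>) z = 0}
      = (I' \<times> J') \<inter> {z. eval2 (Q_poly a b \<zeta>1 \<zeta>2 \<alpha>) z = 0}" (is "?G = ?K")
  proof
    show "?G \<subseteq> ?K"
    proof clarify
      fix x y assume xy: "x \<in> I" "y \<in> J" "eval2 (Q_poly a b \<zeta>1 \<zeta>2 \<alpha>) (x, y) = 0"
      hence "x \<noteq> 0" "y \<noteq> 0" using nz by auto
      from M(2)[OF this xy(3)] show "(x, y) \<in> ?K" using xy I'(3) J'(3) by simp
    qed
  qed (use I'(2) J'(2) in auto)
  thus ?thesis
    by (simp only:) (intro compact_Int_closed compact_Times I' J' closed_Collect_eq eval2_continuous continuous_intros)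
qed

section \<open>Critical points of the curve\<close>

text \<open>One coefficient of \<open>eta2\<close> depends on \<open>f\<close> alone, the other on
  \<open>g\<close> alone. With denominators cleared, their vanishing is the assumption
  \<open>zero\<close> of \<open>quadratic\<close>, for \<open>xi3\<close> at \<open>x\<close> and
  for \<open>xi2\<close> at \<open>y\<close>.\<close>

lemma quadratic_eta2_zero:
  fixes a b \<zeta>1 \<zeta>2 \<alpha> x y :: real
  assumes b: "b \<noteq> 0" and z1: "\<zeta>1 > 0" and z2: "\<zeta>2 > 0" and al: "\<alpha> > 0"
    and xy: "x \<noteq> 0" "y \<noteq> 0" and zero: "form_zero (eta2 a b \<zeta>1 \<zeta>2 \<alpha>) (x, y)"
  shows "quadratic (\<zeta>2\<^sup>2 * ((a - 1)\<^sup>2 + b\<^sup>2)) (2 * \<zeta>1 * \<zeta>2 * (a * (a - 1) + b\<^sup>2))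
      (\<zeta>1\<^sup>2 * (a\<^sup>2 + b\<^sup>2)) (\<alpha> + 1) x" (is "quadratic ?c2 ?c1 ?c0 _ _")
    and "quadratic ((a - 1)\<^sup>2 + b\<^sup>2) (- 2 * (a - 1) * \<zeta>1) (\<zeta>1\<^sup>2) (\<alpha> + 1) y"
      (is "quadratic ?d2 ?d1 ?d0 _ _")
proof -
  define X2 where "X2 = (\<lambda>y. ((a - 1) * y - \<zeta>1)\<^sup>2 + b\<^sup>2 * y\<^sup>2)"
  define X3 where "X3 = (\<lambda>x. ((a - 1) * \<zeta>2 * x + a * \<zeta>1)\<^sup>2 + b\<^sup>2 * (\<zeta>2 * x + \<zeta>1)\<^sup>2)"
  have eq: "- 1 / ((\<alpha> + 1) * x) + deriv X3 x / X3 x = 0" "1 / ((\<alpha> + 1) * y) - deriv X2 y / X2 y = 0"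
    using zero unfolding form_zero_eta2_iff[OF b z1 z2 al xy] X2_def X3_def by auto
  note disc = discriminants[OF b z1 z2]
  have X2: "X2 y = ?d2 * y\<^sup>2 + ?d1 * y + ?d0" and X3: "X3 x = ?c2 * x\<^sup>2 + ?c1 * x + ?c0"
    by (simp_all add: X2_def X3_def power2_eq_square algebra_simps)
  have "deriv X2 y = 2 * ?d2 * y + ?d1"
    unfolding X2_def by (rule DERIV_imp_deriv, (rule derivative_eq_intros refl)+)
      (simp add: power2_eq_square algebra_simps)
  moreover have "deriv X3 x = 2 * ?c2 * x + ?c1"
    unfolding X3_def by (rule DERIV_imp_deriv, (rule derivative_eq_intros refl)+)
      (simp add: power2_eq_square algebra_simps)
  ultimately have d: "deriv X2 y = 2 * ?d2 * y + ?d1" "deriv X3 x = 2 * ?c2 * x + ?c1" by simp_all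
  have pos: "A * t\<^sup>2 + B * t + C > 0" if "A > 0" "4 * A * C > B\<^sup>2" for A B C t :: real
  proof -
    have "4 * A * (A * t\<^sup>2 + B * t + C) = (2 * A * t + B)\<^sup>2 + (4 * A * C - B\<^sup>2)"
      by (simp add: power2_eq_square algebra_simps)
    also have "\<dots> > 0" using that by (intro add_nonneg_pos) simp_all
    finally show ?thesis using that by (simp add: zero_less_mult_iff)
  qed
  have X2p: "X2 y > 0" and X3p: "X3 x > 0" unfolding X2 X3 by (rule pos disc)+
  have "(\<alpha> + 1) * x * deriv X3 x = X3 x" "(\<alpha> + 1) * y * deriv X2 y = X2 y"
    using eq X2p X3p xy al by (simp_all add: divide_simps mult_ac split: if_splits)
  hence "(\<alpha> + 1) * x * (2 * ?c2 * x + ?c1) = ?c2 * x\<^sup>2 + ?c1 * x + ?c0"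
    "(\<alpha> + 1) * y * (2 * ?d2 * y + ?d1) = ?d2 * y\<^sup>2 + ?d1 * y + ?d0"
    unfolding d X2 X3 by simp_all
  thus "quadratic ?c2 ?c1 ?c0 (\<alpha> + 1) x" "quadratic ?d2 ?d1 ?d0 (\<alpha> + 1) y"
    using disc xy al by (simp_all add: quadratic_def)
qed

lemma C1_plane_eval2: "C1_plane (eval2 p) (eval2 (diff_f p)) (eval2 (diff_g p))"
  by unfold_locales (rule eval2_has_derivative eval2_continuous)+

lemma sum_enat_ge_card:
  fixes f :: "'a \<Rightarrow> enat"
  assumes "finite S" "\<And>z. z \<in> S \<Longrightarrow> 1 \<le> f z"
  shows "enat (card S) \<le> sum f S"
proof -
  have "enat (card S) = (\<Sum>z\<in>S. 1)" by (simp add: of_nat_eq_enat)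
  also have "\<dots> \<le> sum f S" by (intro sum_mono assms)
  finally show ?thesis .
qed

theorem proposition2p1:
  fixes a b \<zeta>1 \<zeta>2 \<alpha> :: real and I J :: "real set" and p :: "real \<times> real"
    and Q R :: "real bpoly" and Orb :: "(real \<times> real) set"
  assumes "b \<noteq> 0" and "\<zeta>1 > 0" and "\<zeta>2 > 0" and "\<alpha> > 0"
    and "Q = Q_poly a b \<zeta>1 \<zeta>2 \<alpha>" and "R = R_poly a b \<zeta>1 \<zeta>2 \<alpha>"
    and "I \<in> {{0<..}, {..<0}}" and "J \<in> {{0<..}, {..<0}}"
    and "p \<in> I \<times> J" and "form_zero (eta2 a b \<zeta>1 \<zeta>2 \<alpha>) p"
    and "Orb = connected_component_set (Gamma_curve a b \<zeta>1 \<zeta>2 \<alpha> \<inter> (I \<times> J)) p"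
    and "finite {z :: complex \<times> complex. fst z \<noteq> 0 \<and> snd z \<noteq> 0 \<and>
           eval2 (complexify Q) z = 0 \<and> eval2 (complexify R) z = 0}"
    and "\<forall>z\<in>Orb. (eval2 (diff_f Q) z, eval2 (diff_g Q) z) \<noteq> (0, 0)"
  shows "(\<Sum>z | z \<in> I \<times> J \<and> eval2 Q z = 0 \<and> eval2 R z = 0.
            intersection_mult (complexify Q) (complexify R)
              (complex_of_real (fst z), complex_of_real (snd z))) \<ge> 4"
proof -
  note b = assms(1) and z1 = assms(2) and z2 = assms(3) and al = assms(4) and Q = assms(5)
    and R = assms(6) and I = assms(7) and J = assms(8)
  define k where "k = \<alpha> + 1"
  have k: "k > 1" using al by (simp add: k_def)
  obtain x0 y0 where p: "p = (x0, y0)" by (cases p)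
  have x0: "x0 \<in> I" and y0: "y0 \<in> J" using assms(9) by (auto simp: p)
  have nz: "x * x0 > 0" if "x \<in> I" for x using I x0 that by (auto intro: mult_pos_pos mult_neg_neg)
  have nz': "y * y0 > 0" if "y \<in> J" for y using J y0 that by (auto intro: mult_pos_pos mult_neg_neg)
  have I0: "x \<noteq> 0" if "x \<in> I" for x using nz[OF that] by auto
  have J0: "y \<noteq> 0" if "y \<in> J" for y using nz'[OF that] by auto
  have open_I: "open I" "is_interval I" and open_J: "open J" "is_interval J" using I J by auto

  \<comment> \<open>Factorisation of \<open>R\<close> on the quadrant\<close>
  note quad = quadratic_eta2_zero[OF b z1 z2 al I0[OF x0] J0[OF y0] assms(10)[unfolded p], folded k_def]
  define c2 c1 c0 where "c2 = \<zeta>2\<^sup>2 * ((a - 1)\<^sup>2 + b\<^sup>2)" and "c1 = 2 * \<zeta>1 * \<zeta>2 * (a * (a - 1) + b\<^sup>2)"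
    and "c0 = \<zeta>1\<^sup>2 * (a\<^sup>2 + b\<^sup>2)"
  define d2 d1 d0 where "d2 = (a - 1)\<^sup>2 + b\<^sup>2" and "d1 = - 2 * (a - 1) * \<zeta>1" and "d0 = \<zeta>1\<^sup>2"
  interpret X3: quadratic c2 c1 c0 k x0 unfolding c2_def c1_def c0_def by (rule quad(1))
  interpret X2: quadratic d2 d1 d0 k y0 unfolding d2_def d1_def d0_def by (rule quad(2))
  have xi3: "eval2 (xi3 a b \<zeta>1 \<zeta>2) (x, y) = X3.X x" "eval2 (diff_f (xi3 a b \<zeta>1 \<zeta>2)) (x, y) = X3.X' x" for x y
    unfolding X3.X_def X3.X'_def unfolding c2_def c1_def c0_def by (rule eval2_xi_expand eval2_diff_xi)+
  have xi2: "eval2 (xi2 a b \<zeta>1) (x, y) = X2.X y" "eval2 (diff_g (xi2 a b \<zeta>1)) (x, y) = X2.X' y" for x y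
    unfolding X2.X_def X2.X'_def unfolding d2_def d1_def d0_def by (rule eval2_xi_expand eval2_diff_xi)+
  have n3: "k * x * X3.X' x - X3.X x = (x - x0) * X3.w x * (k * x * X3.X x)" if "x \<in> I" for x
    using X3.numerator_eq I0[OF that] by blast
  have n2: "k * y * X2.X' y - X2.X y = (y - y0) * X2.w y * (k * y * X2.X y)" if "y \<in> J" for y
    using X2.numerator_eq J0[OF that] by blast
  \<comment> \<open>At the saddle each of the two terms of \<open>Q\<close> in
    \<open>eval2_Q\<close> contains a vanishing factor.\<close>
  have Qp: "eval2 Q (x0, y0) = 0"
  proof -
    have "X2.X y0 - k * y0 * X2.X' y0 = 0" "k * x0 * X3.X' x0 - X3.X x0 = 0"
      using n2[OF y0] n3[OF x0] by simp_all
    hence "k\<^sup>2 * eval2 Q (x0, y0) = 0"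
      using eval2_Q[OF b z1 z2 al, of a x0 y0] unfolding Q[symmetric] k_def[symmetric] xi2 xi3 by simp
    thus ?thesis using k by simp
  qed
  \<comment> \<open>The coefficient of \<open>df \<and> dg\<close> in the wedge product of
    \<open>dQ\<close> and \<open>eta2\<close>; \<open>R\<close> differs from it by a factor without
    zeros in the quadrant.\<close>
  define r where "r x y = eval2 (diff_f Q) (x, y) * - ((y - y0) * X2.w y)
      - eval2 (diff_g Q) (x, y) * ((x - x0) * X3.w x)" for x y
  have R_factor: "eval2 R (x, y) = x * y * X2.X y * X3.X x * r x y" if "x \<in> I" "y \<in> J" for x y
  proof -
    have "k * eval2 R (x, y) = x * X3.X x * eval2 (diff_f Q) (x, y) * - (k * y * X2.X' y - X2.X y)
        - y * X2.X y * eval2 (diff_g Q) (x, y) * (k * x * X3.X' x - X3.X x)"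
      using eval2_R[OF b z1 z2 al, of a x y] unfolding Q[symmetric] R[symmetric] k_def[symmetric] xi2 xi3 by simp
    also have "\<dots> = k * (x * y * X2.X y * X3.X x * r x y)"
      unfolding n2[OF that(2)] n3[OF that(1)] r_def by (simp add: algebra_simps)
    finally show ?thesis using k by simp
  qed
  have R0_iff: "eval2 R (x, y) = 0 \<longleftrightarrow> r x y = 0" if "x \<in> I" "y \<in> J" for x y
    using R_factor[OF that] I0[OF that(1)] J0[OF that(2)] X2.X_pos[of y] X3.X_pos[of x] by simp

  \<comment> \<open>The component through \<open>p\<close> as a curve through a saddle\<close>
  interpret Q: C1_plane "eval2 Q" "eval2 (diff_f Q)" "eval2 (diff_g Q)" by (rule C1_plane_eval2)
  interpret R: C1_plane "eval2 R" "eval2 (diff_f R)" "eval2 (diff_g R)" by (rule C1_plane_eval2)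
  let ?G = "{z\<in>I \<times> J. eval2 Q z = 0}"
  have G: "Gamma_curve a b \<zeta>1 \<zeta>2 \<alpha> \<inter> (I \<times> J) = ?G" by (auto simp: Gamma_curve_def Q)
  have Orb: "Orb = connected_component_set ?G p" using assms(11) by (simp add: G)
  have compact_G: "compact ?G" unfolding Q by (rule Gamma_compact[OF b z1 z2 al I J])
  have reg: "(eval2 (diff_f Q) z, eval2 (diff_g Q) z) \<noteq> (0, 0)" if "z \<in> Orb" for z using assms(13) that by blast
  have iso: "compact Orb" "closed (?G - Orb)"
    by (rule Q.component_isolated[OF open_Times[OF open_I(1) open_J(1)] compact_G Orb], erule reg)+
  have p_Orb: "(x0, y0) \<in> Orb" using Qp x0 y0 by (simp add: Orb p)
  interpret saddle: curve_through_saddle "eval2 Q" "eval2 (diff_f Q)" "eval2 (diff_g Q)" I J x0 y0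
    X3.A X3.w "\<lambda>y. - X2.A y" X2.w Orb "?G - Orb"
  proof unfold_locales
    show "Orb \<subseteq> ?G" unfolding Orb by (rule connected_component_subset)
    show "((\<lambda>y. - X2.A y) has_real_derivative - ((y - y0) * X2.w y)) (at y)" if "y \<in> J" for y
      by (rule DERIV_minus[OF X2.A_deriv[OF J0[OF that]]])
    show "(X3.A has_real_derivative (x - x0) * X3.w x) (at x)" if "x \<in> I" for x
      by (rule X3.A_deriv[OF I0[OF that]])
    show "X3.w x > 0" if "x \<in> I" for x by (rule X3.w_pos[OF nz[OF that]])
    show "X2.w y > 0" if "y \<in> J" for y by (rule X2.w_pos[OF nz'[OF that]])
    show "isCont X3.w x0" by (rule X3.w_cont[OF I0[OF x0]])
    show "isCont X2.w y0" by (rule X2.w_cont[OF J0[OF y0]])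
    show "(eval2 (diff_f Q) (x0, y0), eval2 (diff_g Q) (x0, y0)) \<noteq> (0, 0)" by (rule reg[OF p_Orb])
    show "Orb \<inter> (?G - Orb) = {}" "?G \<subseteq> Orb \<union> (?G - Orb)" by auto
  qed (fact open_I open_J x0 y0 p_Orb iso)+

  \<comment> \<open>Counting the solutions with multiplicity\<close>
  let ?S = "{z. z \<in> I \<times> J \<and> eval2 Q z = 0 \<and> eval2 R z = 0}"
  let ?c = "\<lambda>z. (complex_of_real (fst z), complex_of_real (snd z))"
  let ?f = "\<lambda>z. intersection_mult (complexify Q) (complexify R) (?c z)"
  have S: "?S = saddle.crit"
  proof (intro set_eqI iffI)
    fix z assume "z \<in> ?S"
    thus "z \<in> saddle.crit" using R0_iff[of "fst z" "snd z"] by (auto simp: saddle.crit_def r_def)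
  next
    fix z assume "z \<in> saddle.crit"
    thus "z \<in> ?S" using R0_iff[of "fst z" "snd z"] by (auto simp: saddle.crit_def r_def)
  qed
  have evc: "eval2 (complexify q) (?c z) = of_real (eval2 q z)" for q z
    using eval2_complexify[of q "fst z" "snd z"] by simp
  \<comment> \<open>The real solutions in the quadrant embed in the finite set of complex solutions
    with nonzero coordinates.\<close>
  have "finite ?S"
  proof (rule finite_imageD[of ?c])
    show "finite (?c ` ?S)"
      by (rule finite_subset[OF _ assms(12)]) (use I0 J0 evc in auto)
    show "inj_on ?c ?S" by (auto simp: inj_on_def)
  qed
  have ge1: "?f z \<ge> 1" if "z \<in> ?S" for z
    using that by (intro intersection_mult_ge_1) (simp_all add: evc)
  show "sum ?f ?S \<ge> 4"
  \<comment> \<open>Equality means that the second derivative of \<open>H\<close> along the curve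
    vanishes at the saddle.\<close>
  proof (cases "X3.w x0 * (eval2 (diff_g Q) (x0, y0))\<^sup>2 = X2.w y0 * (eval2 (diff_f Q) (x0, y0))\<^sup>2")
    case False
    have "card ?S \<ge> 4" using saddle.four_points[OF _ False] \<open>finite ?S\<close> unfolding S by blast
    hence "4 \<le> enat (card ?S)" by (simp add: numeral_eq_enat)
    also have "\<dots> \<le> sum ?f ?S" by (rule sum_enat_ge_card[OF \<open>finite ?S\<close> ge1])
    finally show ?thesis .
  next
    case True
    define E where "E = x0 * y0 * X2.X y0 * X3.X x0"
    \<comment> \<open>On the line \<open>y = y0\<close> the factorisation of \<open>R\<close> has
      the factor \<open>x - x0\<close>, so the partial derivative of \<open>R\<close> is the value
      of the cofactor at \<open>x0\<close>.\<close>
    have "((\<lambda>x. (x - x0) * (x * y0 * X2.X y0 * X3.X x * (- eval2 (diff_g Q) (x, y0) * X3.w x)))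
        has_real_derivative x0 * y0 * X2.X y0 * X3.X x0 * (- eval2 (diff_g Q) (x0, y0) * X3.w x0)) (at x0)"
    proof (rule DERIV_mult_vanishing)
      have "isCont (\<lambda>x. eval2 (diff_g Q) (x, y0)) x0"
        by (rule DERIV_isCont[OF C1_plane.q_deriv_x[OF C1_plane_eval2]])
      thus "isCont (\<lambda>x. x * y0 * X2.X y0 * X3.X x * (- eval2 (diff_g Q) (x, y0) * X3.w x)) x0"
        by (intro continuous_intros X3.w_cont[OF I0[OF x0]] DERIV_isCont[OF X3.X_deriv])
    qed
    hence "((\<lambda>x. eval2 R (x, y0)) has_real_derivative E * (- eval2 (diff_g Q) (x0, y0) * X3.w x0)) (at x0)"
      unfolding E_def
      by (rule has_field_derivative_transform_within_open[OF _ open_I(1) x0])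
        (use R_factor[OF _ y0] in \<open>simp add: r_def algebra_simps\<close>)
    hence Rx: "eval2 (diff_f R) (x0, y0) = - E * eval2 (diff_g Q) (x0, y0) * X3.w x0"
      using DERIV_unique[OF R.q_deriv_x] by simp
    have "((\<lambda>y. (y - y0) * (x0 * y * X2.X y * X3.X x0 * (- eval2 (diff_f Q) (x0, y) * X2.w y)))
        has_real_derivative x0 * y0 * X2.X y0 * X3.X x0 * (- eval2 (diff_f Q) (x0, y0) * X2.w y0)) (at y0)"
    proof (rule DERIV_mult_vanishing)
      have "isCont (\<lambda>y. eval2 (diff_f Q) (x0, y)) y0"
        by (rule DERIV_isCont[OF C1_plane.q_deriv_y[OF C1_plane_eval2]])
      thus "isCont (\<lambda>y. x0 * y * X2.X y * X3.X x0 * (- eval2 (diff_f Q) (x0, y) * X2.w y)) y0"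
        by (intro continuous_intros X2.w_cont[OF J0[OF y0]] DERIV_isCont[OF X2.X_deriv])
    qed
    hence "((\<lambda>y. eval2 R (x0, y)) has_real_derivative E * (- eval2 (diff_f Q) (x0, y0) * X2.w y0)) (at y0)"
      unfolding E_def
      by (rule has_field_derivative_transform_within_open[OF _ open_J(1) y0])
        (use R_factor[OF x0] in \<open>simp add: r_def algebra_simps\<close>)
    hence Ry: "eval2 (diff_g R) (x0, y0) = - E * eval2 (diff_f Q) (x0, y0) * X2.w y0"
      using DERIV_unique[OF R.q_deriv_y] by simp
    \<comment> \<open>A tangent vector of \<open>Q = 0\<close> at the saddle; the case assumption
      makes it annihilate \<open>dR\<close> as well.\<close>
    define v w where "v = - eval2 (diff_g Q) (x0, y0)" and "w = eval2 (diff_f Q) (x0, y0)"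
    have "v * eval2 (diff_f R) (x0, y0) + w * eval2 (diff_g R) (x0, y0)
        = E * (X3.w x0 * (eval2 (diff_g Q) (x0, y0))\<^sup>2 - X2.w y0 * (eval2 (diff_f Q) (x0, y0))\<^sup>2)"
      unfolding Rx Ry v_def w_def by (simp add: power2_eq_square algebra_simps)
    hence vR: "v * eval2 (diff_f R) (x0, y0) + w * eval2 (diff_g R) (x0, y0) = 0" by (simp add: True)
    have vQ: "v * eval2 (diff_f Q) (x0, y0) + w * eval2 (diff_g Q) (x0, y0) = 0" by (simp add: v_def w_def)
    have pS: "(x0, y0) \<in> ?S" unfolding S by (rule saddle.saddle_crit)
    have p2: "?f (x0, y0) \<ge> 2"
    proof (rule intersection_mult_ge_2[where v = "of_real v" and w = "of_real w"])
      show "(complex_of_real v, complex_of_real w) \<noteq> (0, 0)"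
        using reg[OF p_Orb] by (auto simp: v_def w_def)
      show "of_real v * eval2 (diff_f (complexify Q)) (?c (x0, y0))
          + of_real w * eval2 (diff_g (complexify Q)) (?c (x0, y0)) = 0"
        using arg_cong[OF vQ, of complex_of_real] by (simp add: diff_complexify eval2_complexify)
      show "of_real v * eval2 (diff_f (complexify R)) (?c (x0, y0))
          + of_real w * eval2 (diff_g (complexify R)) (?c (x0, y0)) = 0"
        using arg_cong[OF vR, of complex_of_real] by (simp add: diff_complexify eval2_complexify)
    qed (use pS eval2_complexify in simp_all)
    have "card ?S \<ge> 3" using saddle.three_points \<open>finite ?S\<close> unfolding S by blast
    \<comment> \<open>Two solutions besides the saddle count at least once each, and the saddle
      counts twice.\<close>
    hence "card (?S - {(x0, y0)}) \<ge> 2" using pS \<open>finite ?S\<close> by (simp add: card_Diff_singleton)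
    hence "2 \<le> enat (card (?S - {(x0, y0)}))" by (simp add: numeral_eq_enat)
    also have "\<dots> \<le> sum ?f (?S - {(x0, y0)})"
      by (rule sum_enat_ge_card) (use \<open>finite ?S\<close> ge1 in auto)
    finally have "2 + 2 \<le> ?f (x0, y0) + sum ?f (?S - {(x0, y0)})" using p2 by (rule add_mono[rotated])
    also have "\<dots> = sum ?f ?S" by (rule sum.remove[symmetric, OF \<open>finite ?S\<close> pS])
    finally show ?thesis by simp
  qed
qed

end
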